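(* Let $\mathcal V$ be a congruence modular variety, $\mathbb A\in\mathcal V$, $S\subseteq\mathbb N$ finite with $|S|\ge3$, $\theta_k\in\mathrm{Con}(\mathbb A)$ for $k\in S$, and $Q\subseteq S$ with $Q\neq\emptyset$ and $Q\neq S$. Let $\mathbb B$ be the subalgebra $\Delta(\{\theta_j\}_{j\in S\setminus Q})$ of $\mathbb A^{2^{S\setminus Q}}$ and, for $i\in Q$, let $$\alpha_i=\mathrm{face}_i\Big(\Delta\big(\{\theta_j\}_{j\in\{i\}\cup(S\setminus Q)}\big)\Big).$$ Then each $\alpha_i$ is a congruence of $\mathbb B$, and $$\Delta(\{\theta_k\}_{k\in S})=\mathrm{glue}_Q\Big(\Delta_{\mathbb B}\big(\{\alpha_i\}_{i\in Q}\big)\Big),$$ where $\Delta_{\mathbb B}(\{\alpha_i\}_{i\in Q})\subseteq (A^{2^{S\setminus Q}})^{2^Q}$ is computed in the algebra $\mathbb B$.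
   Context: Cube notation. $2=\{0,1\}$; for finite $S\subseteq\mathbb N$, $2^S$ is the set of functions $S\to 2$, and an $(S)$-cube over a set $A$ is $\gamma=(\gamma_f)_{f\in2^S}\in A^{2^S}$. For $i\in S$, $j\in2$, $\mathrm{face}_i^j(\gamma)\in A^{2^{S\setminus\{i\}}}$ is $g\mapsto\gamma_{g\cup\{(i,j)\}}$; for $R\subseteq A^{2^S}$, $\mathrm{face}_i(R)=\{(\mathrm{face}_i^0\gamma,\mathrm{face}_i^1\gamma):\gamma\in R\}$, a binary relation on $A^{2^{S\setminus\{i\}}}$. For $Q\subseteq S$, $\mathrm{cut}_Q:A^{2^S}\to (A^{2^{S\setminus Q}})^{2^Q}$ sends $\gamma$ to $g\mapsto(h\mapsto\gamma_{g\cup h})_{h\in 2^{S\setminus Q}}$; it is a bijection whose inverse is $\mathrm{glue}_Q$, applied elementwise to sets. $\mathrm{glue}_{\{i\}}(\zeta,\eta)$ is the unique cube with $\mathrm{face}_i^0=\zeta$, $\mathrm{face}_i^1=\eta$; $\mathrm{refl}_i^j(\gamma)=\mathrm{glue}_{\{i\}}(\mathrm{face}_i^j\gamma,\mathrm{face}_i^j\gamma)$; $\mathrm{sym}_i(\gamma)=\mathrm{glue}_{\{i\}}(\mathrm{face}_i^1\gamma,\mathrm{face}_i^0\gamma)$. For $x,y\in A$, $i\in S$, $\mathrm{cube}_i(x,y)\in A^{2^S}$ takes value $x$ where $f(i)=0$ and $y$ where $f(i)=1$. A cube indexed by a one-element set is identified with a pair. Higher dimensional congruences. For an algebra $\mathbb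 C$ and $|S|=m\ge1$, a subuniverse $R$ of $\mathbb C^{2^S}$ is an $(m)$-dimensional tolerance of $\mathbb C$ if $\mathrm{refl}_i^j(\gamma),\mathrm{sym}_i(\gamma)\in R$ for all $\gamma\in R$, $i\in S$, $j\in 2$, and an $(m)$-dimensional congruence if moreover each $\mathrm{face}_i(R)$ is transitive. For $\theta_k\in\mathrm{Con}(\mathbb C)$ ($k\in S$), $M(\{\theta_k\}_{k\in S})$ is the subuniverse of $\mathbb C^{2^S}$ generated by all $\mathrm{cube}_k(x,y)$ with $k\in S$, $(x,y)\in\theta_k$, and $\Delta(\{\theta_k\}_{k\in S})$ (written $\Delta_{\mathbb C}$ when the algebra must be specified) is the smallest $(|S|)$-dimensional congruence of $\mathbb C$ containing $M(\{\theta_k\}_{k\in S})$. For $|S|=1$, $\Delta(\theta)=\theta$. *)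

theory Defs
  imports "HOL-Library.FuncSet"
begin

definition algebra :: "('f \<Rightarrow> nat) \<Rightarrow> 'a set \<Rightarrow> ('f \<Rightarrow> 'a list \<Rightarrow> 'a) \<Rightarrow> bool" where
  "algebra ar A F \<longleftrightarrow> (\<forall>f xs. length xs = ar f \<and> set xs \<subseteq> A \<longrightarrow> F f xs \<in> A)"

definition subuniverse :: "('f \<Rightarrow> nat) \<Rightarrow> 'a set \<Rightarrow> ('f \<Rightarrow> 'a list \<Rightarrow> 'a) \<Rightarrow> 'a set \<Rightarrow> bool" where
  "subuniverse ar A F R \<longleftrightarrow> R \<subseteq> A \<and> (\<forall>f xs. length xs = ar f \<and> set xs \<subseteq> R \<longrightarrow> F f xs \<in> R)"

definition congruence :: "('f \<Rightarrow> nat) \<Rightarrow> 'a set \<Rightarrow> ('f \<Rightarrow> 'a list \<Rightarrow> 'a) \<Rightarrow> 'a rel \<Rightarrow> bool" where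
  "congruence ar A F \<theta> \<longleftrightarrow> equiv A \<theta> \<and>
     (\<forall>f xs ys. length xs = ar f \<longrightarrow> length ys = ar f \<longrightarrow>
        list_all2 (\<lambda>x y. (x, y) \<in> \<theta>) xs ys \<longrightarrow> (F f xs, F f ys) \<in> \<theta>)"

definition con_join :: "('f \<Rightarrow> nat) \<Rightarrow> 'a set \<Rightarrow> ('f \<Rightarrow> 'a list \<Rightarrow> 'a) \<Rightarrow> 'a rel \<Rightarrow> 'a rel \<Rightarrow> 'a rel" where
  "con_join ar A F \<alpha> \<beta> = \<Inter>{\<theta>. congruence ar A F \<theta> \<and> \<alpha> \<union> \<beta> \<subseteq> \<theta>}"

definition con_modular :: "('f \<Rightarrow> nat) \<Rightarrow> 'a set \<Rightarrow> ('f \<Rightarrow> 'a list \<Rightarrow> 'a) \<Rightarrow> bool" where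
  "con_modular ar A F \<longleftrightarrow>
     (\<forall>\<alpha> \<beta> \<gamma>. congruence ar A F \<alpha> \<longrightarrow> congruence ar A F \<beta> \<longrightarrow> congruence ar A F \<gamma> \<longrightarrow>
        \<alpha> \<subseteq> \<gamma> \<longrightarrow> con_join ar A F \<alpha> \<beta> \<inter> \<gamma> = con_join ar A F \<alpha> (\<beta> \<inter> \<gamma>))"

definition pow_ops :: "'i set \<Rightarrow> ('f \<Rightarrow> 'a list \<Rightarrow> 'a) \<Rightarrow> 'f \<Rightarrow> ('i \<Rightarrow> 'a) list \<Rightarrow> ('i \<Rightarrow> 'a)" where
  "pow_ops I F = (\<lambda>f xs. restrict (\<lambda>i. F f (map (\<lambda>x. x i) xs)) I)"

definition in_cm_variety :: "('f \<Rightarrow> nat) \<Rightarrow> 'a set \<Rightarrow> ('f \<Rightarrow> 'a list \<Rightarrow> 'a) \<Rightarrow> bool" where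
  "in_cm_variety ar A F \<longleftrightarrow>
     (\<forall>(I :: (nat \<Rightarrow> 'a) set) C. subuniverse ar (PiE I (\<lambda>_. A)) (pow_ops I F) C \<longrightarrow>
        con_modular ar C (pow_ops I F))"

text \<open>Elements of 2^S are functions S -> {0,1}, represented by their graphs.\<close>
definition two_pow :: "nat set \<Rightarrow> (nat \<times> nat) set set" where
  "two_pow S = {f. f \<subseteq> S \<times> {0, 1} \<and> (\<forall>i\<in>S. \<exists>!j. (i, j) \<in> f)}"

definition cubes :: "nat set \<Rightarrow> 'a set \<Rightarrow> ((nat \<times> nat) set \<Rightarrow> 'a) set" where
  "cubes S A = PiE (two_pow S) (\<lambda>_. A)"

definition cube_face :: "nat set \<Rightarrow> nat \<Rightarrow> nat \<Rightarrow> ((nat \<times> nat) set \<Rightarrow> 'a) \<Rightarrow> ((nat \<times> nat) set \<Rightarrow> 'a)" where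
  "cube_face S i j \<gamma> = restrict (\<lambda>g. \<gamma> (g \<union> {(i, j)})) (two_pow (S - {i}))"

definition face_rel :: "nat set \<Rightarrow> nat \<Rightarrow> ((nat \<times> nat) set \<Rightarrow> 'a) set
    \<Rightarrow> (((nat \<times> nat) set \<Rightarrow> 'a) \<times> ((nat \<times> nat) set \<Rightarrow> 'a)) set" where
  "face_rel S i R = {(cube_face S i 0 \<gamma>, cube_face S i 1 \<gamma>) | \<gamma>. \<gamma> \<in> R}"

definition glue1 :: "nat set \<Rightarrow> nat \<Rightarrow> ((nat \<times> nat) set \<Rightarrow> 'a) \<Rightarrow> ((nat \<times> nat) set \<Rightarrow> 'a)
    \<Rightarrow> ((nat \<times> nat) set \<Rightarrow> 'a)" where
  "glue1 S i \<zeta> \<eta> = restrict (\<lambda>f. if (i, 0) \<in> f then \<zeta> (f - {(i, 0)}) else \<eta> (f - {(i, 1)})) (two_pow S)"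

definition cube_refl :: "nat set \<Rightarrow> nat \<Rightarrow> nat \<Rightarrow> ((nat \<times> nat) set \<Rightarrow> 'a) \<Rightarrow> ((nat \<times> nat) set \<Rightarrow> 'a)" where
  "cube_refl S i j \<gamma> = glue1 S i (cube_face S i j \<gamma>) (cube_face S i j \<gamma>)"

definition cube_sym :: "nat set \<Rightarrow> nat \<Rightarrow> ((nat \<times> nat) set \<Rightarrow> 'a) \<Rightarrow> ((nat \<times> nat) set \<Rightarrow> 'a)" where
  "cube_sym S i \<gamma> = glue1 S i (cube_face S i 1 \<gamma>) (cube_face S i 0 \<gamma>)"

definition cube_const :: "nat set \<Rightarrow> nat \<Rightarrow> 'a \<Rightarrow> 'a \<Rightarrow> ((nat \<times> nat) set \<Rightarrow> 'a)" where
  "cube_const S i x y = restrict (\<lambda>f. if (i, 0) \<in> f then x else y) (two_pow S)"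

definition cube_cut :: "nat set \<Rightarrow> nat set \<Rightarrow> ((nat \<times> nat) set \<Rightarrow> 'a)
    \<Rightarrow> ((nat \<times> nat) set \<Rightarrow> (nat \<times> nat) set \<Rightarrow> 'a)" where
  "cube_cut S Q \<gamma> = restrict (\<lambda>g. restrict (\<lambda>h. \<gamma> (g \<union> h)) (two_pow (S - Q))) (two_pow Q)"

definition cube_glue :: "nat set \<Rightarrow> nat set \<Rightarrow> ((nat \<times> nat) set \<Rightarrow> (nat \<times> nat) set \<Rightarrow> 'a)
    \<Rightarrow> ((nat \<times> nat) set \<Rightarrow> 'a)" where
  "cube_glue S Q \<Gamma> = restrict (\<lambda>f. \<Gamma> (f \<inter> (Q \<times> UNIV)) (f \<inter> ((S - Q) \<times> UNIV))) (two_pow S)"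

definition hd_tolerance :: "('f \<Rightarrow> nat) \<Rightarrow> 'a set \<Rightarrow> ('f \<Rightarrow> 'a list \<Rightarrow> 'a) \<Rightarrow> nat set
    \<Rightarrow> ((nat \<times> nat) set \<Rightarrow> 'a) set \<Rightarrow> bool" where
  "hd_tolerance ar A F S R \<longleftrightarrow>
     subuniverse ar (cubes S A) (pow_ops (two_pow S) F) R \<and>
     (\<forall>\<gamma>\<in>R. \<forall>i\<in>S. (\<forall>j\<in>{0, 1}. cube_refl S i j \<gamma> \<in> R) \<and> cube_sym S i \<gamma> \<in> R)"

definition hd_congruence :: "('f \<Rightarrow> nat) \<Rightarrow> 'a set \<Rightarrow> ('f \<Rightarrow> 'a list \<Rightarrow> 'a) \<Rightarrow> nat set
    \<Rightarrow> ((nat \<times> nat) set \<Rightarrow> 'a) set \<Rightarrow> bool" where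
  "hd_congruence ar A F S R \<longleftrightarrow> hd_tolerance ar A F S R \<and> (\<forall>i\<in>S. trans (face_rel S i R))"

definition M_gen :: "('f \<Rightarrow> nat) \<Rightarrow> 'a set \<Rightarrow> ('f \<Rightarrow> 'a list \<Rightarrow> 'a) \<Rightarrow> nat set
    \<Rightarrow> (nat \<Rightarrow> 'a rel) \<Rightarrow> ((nat \<times> nat) set \<Rightarrow> 'a) set" where
  "M_gen ar A F S \<theta> = \<Inter>{R. subuniverse ar (cubes S A) (pow_ops (two_pow S) F) R \<and>
       {cube_const S k x y | k x y. k \<in> S \<and> (x, y) \<in> \<theta> k} \<subseteq> R}"

definition Delta :: "('f \<Rightarrow> nat) \<Rightarrow> 'a set \<Rightarrow> ('f \<Rightarrow> 'a list \<Rightarrow> 'a) \<Rightarrow> nat set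
    \<Rightarrow> (nat \<Rightarrow> 'a rel) \<Rightarrow> ((nat \<times> nat) set \<Rightarrow> 'a) set" where
  "Delta ar A F S \<theta> = \<Inter>{R. hd_congruence ar A F S R \<and> M_gen ar A F S \<theta> \<subseteq> R}"

end

theory Submission
  imports Defs
begin

text \<open>
  Most of the statement follows from minimality of \<open>\<Delta>\<close>: slices and duplications of cubes map one
  \<open>\<Delta>\<close> into another. The only point that needs modularity is that \<open>\<Delta>\<^sub>B\<close> is transitive in the
  directions \<open>j \<in> S - Q\<close>. Let \<open>\<eta>\<^sub>0\<close>, \<open>\<eta>\<^sub>1\<close> be the kernels of the two faces in direction \<open>j\<close>, so
  that \<open>\<eta>\<^sub>0 \<inter> \<eta>\<^sub>1\<close> is trivial. The composite \<open>(x, z)\<close> of \<open>(x, y)\<close> and \<open>(y, z)\<close> completes these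
  two and \<open>(y, y)\<close> to a rectangle with sides in \<open>\<eta>\<^sub>0\<close> and \<open>\<eta>\<^sub>1\<close>, and two applications of the
  shifting lemma show that a congruence relating three corners of one such rectangle to the
  corresponding corners of another one also relates the fourth corners.
\<close>

subsection \<open>The shifting lemma\<close>

text \<open>Reflections and symmetries in a direction of \<open>S - Q\<close> are total maps: they
  act on \<Delta>_B through endomorphisms of \<open>B\<close> that preserve every
  \<open>\<alpha> i\<close>, so minimality handles them. Composition is defined only for cubes with
  a common face and involves two members of \<Delta>_B at once, while minimality is an induction
  over single members. Hence the detour through a rectangle whose other three corners are already in
  \<Delta>_B; the corner (y, y) comes from a reflection. A congruence can relate the missing corner
  only if that corner belongs to its algebra. This forces an induction on the dimension: both faces
  of the unknown cube have to be placed in the algebra of faces before \<open>face_rel\<close> can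
  be applied to them. The algebras that arise are subalgebras of powers of powers, so the shifting
  lemma is needed for everything that embeds into a finite power of \<open>A\<close>.\<close>

lemma congruenceI:
  assumes "\<And>x y. (x, y) \<in> \<theta> \<Longrightarrow> x \<in> A \<and> y \<in> A"
    and "\<And>x. x \<in> A \<Longrightarrow> (x, x) \<in> \<theta>"
    and "\<And>x y. (x, y) \<in> \<theta> \<Longrightarrow> (y, x) \<in> \<theta>"
    and "\<And>x y z. (x, y) \<in> \<theta> \<Longrightarrow> (y, z) \<in> \<theta> \<Longrightarrow> (x, z) \<in> \<theta>"
    and "\<And>f xs ys. length xs = ar f \<Longrightarrow> length ys = ar f \<Longrightarrow>
      (\<And>n. n < ar f \<Longrightarrow> (xs ! n, ys ! n) \<in> \<theta>) \<Longrightarrow> (F f xs, F f ys) \<in> \<theta>"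
  shows "congruence ar A F \<theta>"
proof -
  have "\<theta> \<subseteq> A \<times> A" using assms(1) by auto
  moreover have "refl_on A \<theta>" using assms(2) by (auto simp: refl_on_def)
  moreover have "sym \<theta>" using assms(3) by (rule symI)
  moreover have "trans \<theta>" using assms(4) by (rule transI)
  ultimately have "equiv A \<theta>" by (rule equivI)
  then show ?thesis
    unfolding congruence_def by (auto simp: list_all2_conv_all_nth intro: assms(5))
qed

lemma congruenceD:
  assumes "congruence ar A F \<theta>"
  shows congruence_in: "(x, y) \<in> \<theta> \<Longrightarrow> x \<in> A \<and> y \<in> A"
    and congruence_refl: "x \<in> A \<Longrightarrow> (x, x) \<in> \<theta>"
    and congruence_sym: "(x, y) \<in> \<theta> \<Longrightarrow> (y, x) \<in> \<theta>"
    and congruence_trans: "(x, y) \<in> \<theta> \<Longrightarrow> (y, z) \<in> \<theta> \<Longrightarrow> (x, z) \<in> \<theta>"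
    and congruence_op: "length xs = ar f \<Longrightarrow> length ys = ar f \<Longrightarrow>
      (\<And>n. n < ar f \<Longrightarrow> (xs ! n, ys ! n) \<in> \<theta>) \<Longrightarrow> (F f xs, F f ys) \<in> \<theta>"
proof -
  have e: "equiv A \<theta>" using assms by (simp add: congruence_def)
  show "(x, y) \<in> \<theta> \<Longrightarrow> x \<in> A \<and> y \<in> A" using e by (auto dest: equiv_type)
  show "x \<in> A \<Longrightarrow> (x, x) \<in> \<theta>" using e by (auto simp: equiv_def refl_on_def)
  show "(x, y) \<in> \<theta> \<Longrightarrow> (y, x) \<in> \<theta>" using e by (auto simp: equiv_def dest: symD)
  show "(x, y) \<in> \<theta> \<Longrightarrow> (y, z) \<in> \<theta> \<Longrightarrow> (x, z) \<in> \<theta>"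
    using e by (auto simp: equiv_def dest: transD)
  show "length xs = ar f \<Longrightarrow> length ys = ar f \<Longrightarrow>
      (\<And>n. n < ar f \<Longrightarrow> (xs ! n, ys ! n) \<in> \<theta>) \<Longrightarrow> (F f xs, F f ys) \<in> \<theta>"
    using assms by (auto simp: congruence_def list_all2_conv_all_nth)
qed

lemma congruence_Int:
  assumes "congruence ar A F \<alpha>" "congruence ar A F \<beta>"
  shows "congruence ar A F (\<alpha> \<inter> \<beta>)"
proof (rule congruenceI)
  fix f xs ys
  assume "length xs = ar f" "length ys = ar f" "\<And>n. n < ar f \<Longrightarrow> (xs ! n, ys ! n) \<in> \<alpha> \<inter> \<beta>"
  then show "(F f xs, F f ys) \<in> \<alpha> \<inter> \<beta>"
    using congruence_op[OF assms(1)] congruence_op[OF assms(2)] by simp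
next
  fix x y z assume "(x, y) \<in> \<alpha> \<inter> \<beta>" "(y, z) \<in> \<alpha> \<inter> \<beta>"
  then show "(x, z) \<in> \<alpha> \<inter> \<beta>"
    using congruence_trans[OF assms(1)] congruence_trans[OF assms(2)] by blast
qed (use congruenceD(1-3)[OF assms(1)] congruenceD(1-3)[OF assms(2)] in \<open>blast+\<close>)

text \<open>This is Gumm's shifting lemma. The path from \<open>a\<close> over \<open>b\<close> and
  \<open>d\<close> to \<open>c\<close> has steps in \<beta>, \<alpha> \<inter> \<gamma> and \<beta>,
  and \<open>(a, c)\<close> is in \<alpha>. As \<alpha> \<inter> \<gamma> lies below \<alpha>, the
  modular law moves the meet with \<alpha> inside the join, where both joinands lie below
  \<gamma>.\<close>

lemma con_modular_shifting:
  assumes mod: "con_modular ar C G"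
    and \<alpha>: "congruence ar C G \<alpha>" and \<beta>: "congruence ar C G \<beta>" and \<gamma>: "congruence ar C G \<gamma>"
    and le: "\<alpha> \<inter> \<beta> \<subseteq> \<gamma>"
    and edges: "(a, b) \<in> \<beta>" "(c, d) \<in> \<beta>" "(a, c) \<in> \<alpha>" "(b, d) \<in> \<alpha>" "(b, d) \<in> \<gamma>"
  shows "(a, c) \<in> \<gamma>"
proof -
  have "(a, c) \<in> con_join ar C G (\<alpha> \<inter> \<gamma>) \<beta>"
    unfolding con_join_def using edges by (auto, meson congruence_sym congruence_trans IntI subsetD)
  then have "(a, c) \<in> con_join ar C G (\<alpha> \<inter> \<gamma>) \<beta> \<inter> \<alpha>"
    using edges by simp
  also have "\<dots> = con_join ar C G (\<alpha> \<inter> \<gamma>) (\<beta> \<inter> \<alpha>)"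
    using mod \<alpha> \<beta> congruence_Int[OF \<alpha> \<gamma>] by (auto simp: con_modular_def)
  also have "\<dots> \<subseteq> \<gamma>"
    unfolding con_join_def using \<gamma> le by auto
  finally show ?thesis .
qed

text \<open>The coordinates \<open>e\<close> embed \<open>C\<close> into the power \<open>A\<^sup>I\<close>. Here \<open>I\<close> has an arbitrary type, whereas
  the powers in the definition of \<open>in_cm_variety\<close> are indexed by functions from \<open>nat\<close> to the type of
  \<open>A\<close>; a finite \<open>I\<close> embeds there as soon as \<open>A\<close> has two elements.\<close>
definition separated_by ::
  "('f \<Rightarrow> nat) \<Rightarrow> 'a set \<Rightarrow> ('f \<Rightarrow> 'a list \<Rightarrow> 'a) \<Rightarrow> 'c set \<Rightarrow> ('f \<Rightarrow> 'c list \<Rightarrow> 'c)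
    \<Rightarrow> 'i set \<Rightarrow> ('i \<Rightarrow> 'c \<Rightarrow> 'a) \<Rightarrow> bool" where
  "separated_by ar A F C G I e \<longleftrightarrow> algebra ar C G \<and> (\<forall>i\<in>I. \<forall>x\<in>C. e i x \<in> A) \<and>
     (\<forall>i\<in>I. \<forall>f xs. length xs = ar f \<longrightarrow> set xs \<subseteq> C \<longrightarrow> e i (G f xs) = F f (map (e i) xs)) \<and>
     (\<forall>x\<in>C. \<forall>y\<in>C. (\<forall>i\<in>I. e i x = e i y) \<longrightarrow> x = y)"

lemma algebra_op: "algebra ar A F \<Longrightarrow> length xs = ar f \<Longrightarrow> set xs \<subseteq> A \<Longrightarrow> F f xs \<in> A"
  by (simp add: algebra_def)

text \<open>Injectivity serves transitivity: the two preimages of the middle element have to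
  coincide. For the operations, preimages are chosen separately in each argument position.\<close>

lemma congruence_image:
  assumes inj: "inj_on \<phi> C"
    and hom: "\<And>f xs. length xs = ar f \<Longrightarrow> set xs \<subseteq> C \<Longrightarrow> \<phi> (G f xs) = H f (map \<phi> xs)"
    and \<theta>: "congruence ar C G \<theta>"
  shows "congruence ar (\<phi> ` C) H (map_prod \<phi> \<phi> ` \<theta>)"
proof (rule congruenceI)
  note D = congruenceD[OF \<theta>]
  show "x \<in> \<phi> ` C \<and> y \<in> \<phi> ` C" if "(x, y) \<in> map_prod \<phi> \<phi> ` \<theta>" for x y
    using that D(1) by auto
  show "(x, x) \<in> map_prod \<phi> \<phi> ` \<theta>" if "x \<in> \<phi> ` C" for x
    using that D(2) by force
  show "(y, x) \<in> map_prod \<phi> \<phi> ` \<theta>" if "(x, y) \<in> map_prod \<phi> \<phi> ` \<theta>" for x y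
    using that D(3) by force
  show "(x, z) \<in> map_prod \<phi> \<phi> ` \<theta>"
    if xy: "(x, y) \<in> map_prod \<phi> \<phi> ` \<theta>" and yz: "(y, z) \<in> map_prod \<phi> \<phi> ` \<theta>" for x y z
  proof -
    obtain a b where ab: "(a, b) \<in> \<theta>" "x = \<phi> a" "y = \<phi> b" using xy by auto
    obtain b' c where bc: "(b', c) \<in> \<theta>" "y = \<phi> b'" "z = \<phi> c" using yz by auto
    have "b = b'" using ab bc D(1) inj by (metis inj_onD)
    then have "(a, c) \<in> \<theta>" using ab bc D(4) by blast
    then show ?thesis using ab bc by force
  qed
  show "(H f xs, H f ys) \<in> map_prod \<phi> \<phi> ` \<theta>"
    if len: "length xs = ar f" "length ys = ar f"
      and rel: "\<And>n. n < ar f \<Longrightarrow> (xs ! n, ys ! n) \<in> map_prod \<phi> \<phi> ` \<theta>" for f xs ys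
  proof -
    have "\<forall>n. n < ar f \<longrightarrow> (\<exists>p. p \<in> \<theta> \<and> xs ! n = \<phi> (fst p) \<and> ys ! n = \<phi> (snd p))"
    proof (intro allI impI)
      fix n assume "n < ar f"
      from rel[OF this] show "\<exists>p. p \<in> \<theta> \<and> xs ! n = \<phi> (fst p) \<and> ys ! n = \<phi> (snd p)"
        by force
    qed
    then obtain p where p: "\<And>n. n < ar f \<Longrightarrow> p n \<in> \<theta> \<and> xs ! n = \<phi> (fst (p n)) \<and> ys ! n = \<phi> (snd (p n))"
      by metis
    define us where "us = map (\<lambda>n. fst (p n)) [0..<ar f]"
    define vs where "vs = map (\<lambda>n. snd (p n)) [0..<ar f]"
    have xs: "xs = map \<phi> us" and ys: "ys = map \<phi> vs"
      using len p by (auto simp: us_def vs_def intro!: nth_equalityI)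
    have "fst (p n) \<in> C \<and> snd (p n) \<in> C" if "n < ar f" for n
      using p[OF that] D(1)[of "fst (p n)" "snd (p n)"] by simp
    then have sub: "set us \<subseteq> C" "set vs \<subseteq> C"
      by (auto simp: us_def vs_def)
    have "(G f us, G f vs) \<in> \<theta>"
      using p by (intro D(5)) (auto simp: us_def vs_def)
    moreover have "H f xs = \<phi> (G f us)" "H f ys = \<phi> (G f vs)"
      using sub xs ys hom by (auto simp: us_def vs_def)
    ultimately show ?thesis by force
  qed
qed

lemma separated_shifting:
  assumes cm: "in_cm_variety ar A F" and fin: "finite I" and sep: "separated_by ar A F C G I e"
    and \<alpha>: "congruence ar C G \<alpha>" and \<beta>: "congruence ar C G \<beta>" and \<gamma>: "congruence ar C G \<gamma>"
    and le: "\<alpha> \<inter> \<beta> \<subseteq> \<gamma>"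
    and edges: "(a, b) \<in> \<beta>" "(c, d) \<in> \<beta>" "(a, c) \<in> \<alpha>" "(b, d) \<in> \<alpha>" "(b, d) \<in> \<gamma>"
  shows "(a, c) \<in> \<gamma>"
proof (cases "\<exists>u\<in>A. \<exists>v\<in>A. u \<noteq> v")
  \<comment> \<open>Here separation leaves \<open>C\<close> with at most one element.\<close>
  case False
  have "a \<in> C" "c \<in> C" using congruence_in[OF \<alpha>] edges by auto
  moreover from this have "a = c" using False sep unfolding separated_by_def by meson
  ultimately show ?thesis using congruence_refl[OF \<gamma>] by simp
next
  case True
  then obtain u v where uv: "u \<in> A" "v \<in> A" "u \<noteq> v" by blast
  obtain t :: "'c \<Rightarrow> nat" where t: "inj_on t I"
    using finite_imp_inj_to_nat_seg[OF fin] by blast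
  \<comment> \<open>Each index is coded by a function of the type required in
    \<open>in_cm_variety\<close>: value \<open>u\<close> at its number under \<open>t\<close>, value
    \<open>v\<close> elsewhere. Codes of different indices differ because \<open>u\<close> and
    \<open>v\<close> do.\<close>
  define h where "h i = (\<lambda>n. if n = t i then u else v)" for i
  have hinj: "inj_on h I"
  proof (rule inj_onI)
    fix i k assume "i \<in> I" "k \<in> I" "h i = h k"
    from fun_cong[OF this(3), of "t i"] have "t i = t k" using uv by (auto simp: h_def split: if_splits)
    then show "i = k" using t \<open>i \<in> I\<close> \<open>k \<in> I\<close> by (auto dest: inj_onD)
  qed
  define \<phi> where "\<phi> x = restrict (\<lambda>j. e (inv_into I h j) x) (h ` I)" for x
  have \<phi>h: "\<phi> x (h i) = e i x" if "i \<in> I" for x i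
    using that hinj by (simp add: \<phi>_def)
  have \<phi>inj: "inj_on \<phi> C"
  proof (rule inj_onI)
    fix x y assume "x \<in> C" "y \<in> C" "\<phi> x = \<phi> y"
    then show "x = y" using sep \<phi>h unfolding separated_by_def by metis
  qed
  let ?H = "pow_ops (h ` I) F"
  have hom: "\<phi> (G f xs) = ?H f (map \<phi> xs)" if "length xs = ar f" "set xs \<subseteq> C" for f xs
  proof
    fix j
    show "\<phi> (G f xs) j = ?H f (map \<phi> xs) j"
    proof (cases "j \<in> h ` I")
      case True
      then obtain i where "i \<in> I" "j = h i" by auto
      then show ?thesis using sep that
        by (auto simp: \<phi>h pow_ops_def separated_by_def comp_def)
    qed (simp add: \<phi>_def pow_ops_def)
  qed
  have "subuniverse ar (PiE (h ` I) (\<lambda>_. A)) ?H (\<phi> ` C)"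
    unfolding subuniverse_def
  proof (intro conjI allI impI subsetI)
    fix x assume "x \<in> \<phi> ` C"
    then obtain y where "y \<in> C" "x = \<phi> y" by auto
    then show "x \<in> PiE (h ` I) (\<lambda>_. A)"
      using sep hinj by (auto simp: \<phi>_def separated_by_def PiE_iff)
  next
    fix f xs assume xs: "length xs = ar f \<and> set xs \<subseteq> \<phi> ` C"
    then obtain ys where ys: "ys \<in> lists C" "xs = map \<phi> ys"
      by (metis in_lists_conv_set lists_image image_iff subset_eq)
    then have "?H f xs = \<phi> (G f ys)" using hom[of ys f] xs by (auto simp: subset_iff)
    moreover have "G f ys \<in> C"
      using sep xs ys by (auto simp: separated_by_def algebra_def subset_iff)
    ultimately show "?H f xs \<in> \<phi> ` C" by auto
  qed
  then have "con_modular ar (\<phi> ` C) ?H"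
    using cm unfolding in_cm_variety_def by blast
  note sh = con_modular_shifting[OF this congruence_image[OF \<phi>inj hom \<alpha>]
      congruence_image[OF \<phi>inj hom \<beta>] congruence_image[OF \<phi>inj hom \<gamma>]]
  have inC: "x \<in> C \<and> y \<in> C" if "(x, y) \<in> \<alpha> \<union> \<beta> \<union> \<gamma>" for x y
    using that congruence_in[OF \<alpha>] congruence_in[OF \<beta>] congruence_in[OF \<gamma>] by blast
  have img: "(\<phi> x, \<phi> y) \<in> map_prod \<phi> \<phi> ` \<theta>" if "(x, y) \<in> \<theta>" for x y \<theta>
    using imageI[OF that, of "map_prod \<phi> \<phi>"] by simp
  \<comment> \<open>The bound on \<theta> only places its pairs in \<open>C\<close>, where \<phi> is
    injective; one statement then serves both \<beta> and \<gamma>.\<close>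
  have reflect: "(x, y) \<in> \<theta> \<longleftrightarrow> (\<phi> x, \<phi> y) \<in> map_prod \<phi> \<phi> ` \<theta>"
    if "x \<in> C" "y \<in> C" "\<theta> \<subseteq> \<alpha> \<union> \<beta> \<union> \<gamma>" for x y \<theta>
  proof
    assume "(\<phi> x, \<phi> y) \<in> map_prod \<phi> \<phi> ` \<theta>"
    then obtain x' y' where "(x', y') \<in> \<theta>" "\<phi> x = \<phi> x'" "\<phi> y = \<phi> y'" by auto
    moreover from this have "x' \<in> C" "y' \<in> C" using inC that(3) by blast+
    ultimately show "(x, y) \<in> \<theta>" using that \<phi>inj by (metis inj_onD)
  qed (rule img)
  have "(\<phi> a, \<phi> c) \<in> map_prod \<phi> \<phi> ` \<gamma>"
  proof (rule sh[of "\<phi> a" "\<phi> b" "\<phi> c" "\<phi> d"])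
    show "map_prod \<phi> \<phi> ` \<alpha> \<inter> map_prod \<phi> \<phi> ` \<beta> \<subseteq> map_prod \<phi> \<phi> ` \<gamma>"
    proof
      fix p assume p: "p \<in> map_prod \<phi> \<phi> ` \<alpha> \<inter> map_prod \<phi> \<phi> ` \<beta>"
      then obtain x y where "(x, y) \<in> \<alpha>" "p = (\<phi> x, \<phi> y)" by auto
      moreover have "x \<in> C" "y \<in> C" using inC calculation(1) by blast+
      ultimately have "(x, y) \<in> \<beta>" using p reflect[of x y \<beta>] by auto
      then have "(x, y) \<in> \<gamma>" using le \<open>(x, y) \<in> \<alpha>\<close> by blast
      then show "p \<in> map_prod \<phi> \<phi> ` \<gamma>"
        using \<open>p = (\<phi> x, \<phi> y)\<close> img by simp
    qed
    show "(\<phi> a, \<phi> b) \<in> map_prod \<phi> \<phi> ` \<beta>" "(\<phi> c, \<phi> d) \<in> map_prod \<phi> \<phi> ` \<beta>"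
      "(\<phi> a, \<phi> c) \<in> map_prod \<phi> \<phi> ` \<alpha>" "(\<phi> b, \<phi> d) \<in> map_prod \<phi> \<phi> ` \<alpha>"
      "(\<phi> b, \<phi> d) \<in> map_prod \<phi> \<phi> ` \<gamma>"
      using edges by (simp_all add: img)
  qed
  moreover have "a \<in> C" "c \<in> C" using congruence_in[OF \<alpha> edges(3)] by auto
  ultimately show ?thesis using reflect[of a c \<gamma>] by auto
qed

text \<open>The congruence \<open>\<eta>\<^sub>0\<close>, viewed as a subalgebra of the square, is where the second application of
  the shifting lemma takes place; the first one verifies its hypothesis.\<close>
lemma rectangle_transfer:
  assumes cm: "in_cm_variety ar A F" and fin: "finite I" and sep: "separated_by ar A F C G I e"
    and R: "congruence ar C G R" and \<eta>0: "congruence ar C G \<eta>\<^sub>0" and \<eta>1: "congruence ar C G \<eta>\<^sub>1"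
    and disj: "\<eta>\<^sub>0 \<inter> \<eta>\<^sub>1 \<subseteq> R"
    and p: "(p1, p2) \<in> \<eta>\<^sub>0" "(p2, p3) \<in> \<eta>\<^sub>1" "(p4, p3) \<in> \<eta>\<^sub>0" "(p1, p4) \<in> \<eta>\<^sub>1"
    and q: "(q1, q2) \<in> \<eta>\<^sub>0" "(q2, q3) \<in> \<eta>\<^sub>1" "(q4, q3) \<in> \<eta>\<^sub>0" "(q1, q4) \<in> \<eta>\<^sub>1"
    and r: "(p2, q2) \<in> R" "(p3, q3) \<in> R" "(p4, q4) \<in> R"
  shows "(p1, q1) \<in> R"
proof -
  \<comment> \<open>\<open>H\<close> is the componentwise structure on pairs. The Boolean index of
    \<open>e'\<close> tells which component is read, so the coordinates remain finite in
    number.\<close>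
  define H where "H f zs = (G f (map fst zs), G f (map snd zs))" for f zs
  define e' where "e' = (\<lambda>(k, i) z. e i (if k then fst z else snd z))"
  \<comment> \<open>On pairs, \<alpha> compares second components modulo \<open>R\<close>, \<gamma>
    compares first components modulo \<open>R\<close>, and \<beta> compares both modulo
    \<open>\<eta>\<^sub>1\<close>. The goal is that \<gamma> relates the pairs
    \<open>(p1, p2)\<close> and \<open>(q1, q2)\<close>.\<close>
  define \<alpha> where "\<alpha> = {(z, w). z \<in> \<eta>\<^sub>0 \<and> w \<in> \<eta>\<^sub>0 \<and> (snd z, snd w) \<in> R}"
  define \<beta> where "\<beta> = {(z, w). z \<in> \<eta>\<^sub>0 \<and> w \<in> \<eta>\<^sub>0 \<and> (fst z, fst w) \<in> \<eta>\<^sub>1 \<and> (snd z, snd w) \<in> \<eta>\<^sub>1}"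
  define \<gamma> where "\<gamma> = {(z, w). z \<in> \<eta>\<^sub>0 \<and> w \<in> \<eta>\<^sub>0 \<and> (fst z, fst w) \<in> R}"
  note D0 = congruenceD[OF \<eta>0] and D1 = congruenceD[OF \<eta>1] and DR = congruenceD[OF R]
  have in0: "fst z \<in> C" "snd z \<in> C" if "z \<in> \<eta>\<^sub>0" for z
    using that D0(1)[of "fst z" "snd z"] by auto
  have sub0: "fst ` set zs \<subseteq> C \<and> snd ` set zs \<subseteq> C" if "set zs \<subseteq> \<eta>\<^sub>0" for zs
    using that D0(1) by fastforce
  have H0: "H f zs \<in> \<eta>\<^sub>0" if "length zs = ar f" "set zs \<subseteq> \<eta>\<^sub>0" for f zs
    unfolding H_def using that by (intro D0(5)) (auto dest!: nth_mem)
  have "algebra ar \<eta>\<^sub>0 H" using H0 by (simp add: algebra_def)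
  moreover have "e' k (H f zs) = F f (map (e' k) zs)"
    if "k \<in> UNIV \<times> I" "length zs = ar f" "set zs \<subseteq> \<eta>\<^sub>0" for k f zs
    using that sep sub0[of zs] by (cases k) (auto simp: e'_def H_def separated_by_def comp_def)
  moreover have "z = w"
    if zw: "z \<in> \<eta>\<^sub>0" "w \<in> \<eta>\<^sub>0" and eq: "\<forall>k\<in>UNIV \<times> I. e' k z = e' k w" for z w
  proof -
    have "e i (fst z) = e i (fst w)" "e i (snd z) = e i (snd w)" if "i \<in> I" for i
      using that eq[THEN bspec, of "(True, i)"] eq[THEN bspec, of "(False, i)"]
      by (auto simp: e'_def)
    moreover have "fst z \<in> C" "snd z \<in> C" "fst w \<in> C" "snd w \<in> C"
      using zw D0(1) by (metis prod.collapse)+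
    ultimately show ?thesis using sep unfolding separated_by_def by (metis prod.expand)
  qed
  moreover have "e' k z \<in> A" if "k \<in> UNIV \<times> I" "z \<in> \<eta>\<^sub>0" for k z
    using that sep D0(1)[of "fst z" "snd z"] by (cases k) (auto simp: e'_def separated_by_def)
  ultimately have sep': "separated_by ar A F \<eta>\<^sub>0 H (UNIV \<times> I) e'"
    unfolding separated_by_def by blast
  have H0': "H f xs \<in> \<eta>\<^sub>0 \<and> H f ys \<in> \<eta>\<^sub>0"
    if "length xs = ar f" "length ys = ar f" "\<And>n. n < ar f \<Longrightarrow> xs ! n \<in> \<eta>\<^sub>0 \<and> ys ! n \<in> \<eta>\<^sub>0" for f xs ys
    using that by (metis H0 in_set_conv_nth subsetI)
  have \<alpha>: "congruence ar \<eta>\<^sub>0 H \<alpha>"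
  proof (rule congruenceI)
    fix f xs ys assume "length xs = ar f" "length ys = ar f" "\<And>n. n < ar f \<Longrightarrow> (xs ! n, ys ! n) \<in> \<alpha>"
    then show "(H f xs, H f ys) \<in> \<alpha>"
      using H0'[of xs f ys] by (auto simp: \<alpha>_def H_def intro!: DR(5))
  next
    fix x y z assume "(x, y) \<in> \<alpha>" "(y, z) \<in> \<alpha>"
    then show "(x, z) \<in> \<alpha>" using DR(4) unfolding \<alpha>_def by blast
  next
    fix x y assume "(x, y) \<in> \<alpha>"
    then show "(y, x) \<in> \<alpha>" using DR(3) unfolding \<alpha>_def by blast
  next
    fix x assume "x \<in> \<eta>\<^sub>0"
    then show "(x, x) \<in> \<alpha>" using in0[of x] DR(2) by (simp add: \<alpha>_def)
  qed (simp add: \<alpha>_def)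
  have \<gamma>: "congruence ar \<eta>\<^sub>0 H \<gamma>"
  proof (rule congruenceI)
    fix f xs ys assume "length xs = ar f" "length ys = ar f" "\<And>n. n < ar f \<Longrightarrow> (xs ! n, ys ! n) \<in> \<gamma>"
    then show "(H f xs, H f ys) \<in> \<gamma>"
      using H0'[of xs f ys] by (auto simp: \<gamma>_def H_def intro!: DR(5))
  next
    fix x y z assume "(x, y) \<in> \<gamma>" "(y, z) \<in> \<gamma>"
    then show "(x, z) \<in> \<gamma>" using DR(4) unfolding \<gamma>_def by blast
  next
    fix x y assume "(x, y) \<in> \<gamma>"
    then show "(y, x) \<in> \<gamma>" using DR(3) unfolding \<gamma>_def by blast
  next
    fix x assume "x \<in> \<eta>\<^sub>0"
    then show "(x, x) \<in> \<gamma>" using in0[of x] DR(2) by (simp add: \<gamma>_def)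
  qed (simp add: \<gamma>_def)
  have \<beta>: "congruence ar \<eta>\<^sub>0 H \<beta>"
  proof (rule congruenceI)
    fix f xs ys assume "length xs = ar f" "length ys = ar f" "\<And>n. n < ar f \<Longrightarrow> (xs ! n, ys ! n) \<in> \<beta>"
    then show "(H f xs, H f ys) \<in> \<beta>"
      using H0'[of xs f ys] by (auto simp: \<beta>_def H_def intro!: D1(5))
  next
    fix x y z assume "(x, y) \<in> \<beta>" "(y, z) \<in> \<beta>"
    then show "(x, z) \<in> \<beta>" using D1(4) unfolding \<beta>_def by blast
  next
    fix x y assume "(x, y) \<in> \<beta>"
    then show "(y, x) \<in> \<beta>" using D1(3) unfolding \<beta>_def by blast
  next
    fix x assume "x \<in> \<eta>\<^sub>0"
    then show "(x, x) \<in> \<beta>" using in0[of x] D1(2) by (simp add: \<beta>_def)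
  qed (simp add: \<beta>_def)
  \<comment> \<open>Shifting in \<open>C\<close>: two pairs of \<open>\<eta>\<^sub>0\<close> form a
    rectangle with sides in \<open>\<eta>\<^sub>0\<close> and \<open>\<eta>\<^sub>1\<close>, and
    \<open>R\<close> passes from the side of second components to the side of first
    components.\<close>
  have "\<alpha> \<inter> \<beta> \<subseteq> \<gamma>"
  proof
    fix x assume "x \<in> \<alpha> \<inter> \<beta>"
    then obtain a b c d where x: "x = ((a, b), (c, d))"
      and abcd: "(a, b) \<in> \<eta>\<^sub>0" "(c, d) \<in> \<eta>\<^sub>0" "(b, d) \<in> R" "(a, c) \<in> \<eta>\<^sub>1" "(b, d) \<in> \<eta>\<^sub>1"
      by (auto simp: \<alpha>_def \<beta>_def)
    have "(a, c) \<in> R"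
      by (rule separated_shifting[OF cm fin sep \<eta>1 \<eta>0 R _ abcd(1,2,4,5,3)]) (use disj in auto)
    then show "x \<in> \<gamma>" using x abcd by (simp add: \<gamma>_def)
  qed
  \<comment> \<open>Shifting in \<open>\<eta>\<^sub>0\<close>: the \<beta>-sides are the two given
    rectangles, each read as a pair of its \<open>\<eta>\<^sub>0\<close>-edges. The relations at
    corners 2 and 3 give the \<alpha>-sides, and the one at corner 4 gives the \<gamma>-side to be
    shifted.\<close>
  then have "((p1, p2), (q1, q2)) \<in> \<gamma>"
    using fin p q r
    by (intro separated_shifting[OF cm _ sep' \<alpha> \<beta> \<gamma>, of "(p1, p2)" "(p4, p3)" "(q1, q2)" "(q4, q3)"])
      (auto simp: \<alpha>_def \<beta>_def \<gamma>_def)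
  then show ?thesis by (simp add: \<gamma>_def)
qed

subsection \<open>Cubes and higher dimensional congruences\<close>

text \<open>Overwriting a coordinate stays inside \<open>two_pow S\<close>, so reflections and
  symmetries become precomposition with a map of vertices, whereas \<open>cube_face\<close> changes
  the index set.\<close>

definition set_coord :: "nat \<Rightarrow> nat \<Rightarrow> (nat \<times> nat) set \<Rightarrow> (nat \<times> nat) set" where
  "set_coord i j f = f - {i} \<times> UNIV \<union> {(i, j)}"

definition flip_coord :: "nat \<Rightarrow> (nat \<times> nat) set \<Rightarrow> (nat \<times> nat) set" where
  "flip_coord i f = set_coord i (if (i, 0) \<in> f then 1 else 0) f"

section \<open>Vertices under overwriting, restriction and union\<close>

lemma two_pow_iff:
  "f \<in> two_pow S \<longleftrightarrow> f \<subseteq> S \<times> {0, 1} \<and> (\<forall>i\<in>S. (i, 1) \<in> f \<longleftrightarrow> (i, 0) \<notin> f)"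
proof -
  have "(\<exists>!j. (i, j) \<in> f) \<longleftrightarrow> ((i, 1) \<in> f \<longleftrightarrow> (i, 0) \<notin> f)" if sub: "f \<subseteq> S \<times> {0, 1}" for i
  proof -
    have "(i, j) \<in> f \<longleftrightarrow> j = 0 \<and> (i, 0) \<in> f \<or> j = 1 \<and> (i, 1) \<in> f" for j using sub by auto
    then have *: "(\<lambda>j. (i, j) \<in> f) = (\<lambda>j. j = 0 \<and> (i, 0) \<in> f \<or> j = 1 \<and> (i, 1) \<in> f)" by blast
    show ?thesis by (subst *) auto
  qed
  then show ?thesis by (simp add: two_pow_def cong: conj_cong)
qed

lemma two_pow_coord: "f \<in> two_pow S \<Longrightarrow> i \<in> S \<Longrightarrow> (i, Suc 0) \<in> f \<longleftrightarrow> (i, 0) \<notin> f"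
  by (simp add: two_pow_iff)

lemma two_pow_in: "f \<in> two_pow S \<Longrightarrow> (i, j) \<in> f \<Longrightarrow> i \<in> S \<and> (j = 0 \<or> j = Suc 0)"
  by (auto simp: two_pow_iff)

lemma finite_two_pow: "finite S \<Longrightarrow> finite (two_pow S)"
  by (rule finite_subset[of _ "Pow (S \<times> {0, 1})"]) (auto simp: two_pow_iff)

lemma two_pow_empty: "two_pow {} = {{}}"
  by (auto simp: two_pow_def)

lemma set_coord_in [simp]:
  "f \<in> two_pow S \<Longrightarrow> i \<in> S \<Longrightarrow> j = 0 \<or> j = Suc 0 \<Longrightarrow> set_coord i j f \<in> two_pow S"
  by (auto simp: two_pow_iff set_coord_def)

lemma flip_coord_in [simp]: "f \<in> two_pow S \<Longrightarrow> i \<in> S \<Longrightarrow> flip_coord i f \<in> two_pow S"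
  by (simp add: flip_coord_def)

lemma two_pow_unique: "f \<in> two_pow S \<Longrightarrow> (i, j) \<in> f \<Longrightarrow> (i, k) \<in> f \<Longrightarrow> j = k"
  unfolding two_pow_def by blast

lemma set_coord_id: "f \<in> two_pow S \<Longrightarrow> (i, j) \<in> f \<Longrightarrow> set_coord i j f = f"
  unfolding set_coord_def by (blast dest: two_pow_unique)

lemma set_coord_mem [simp]: "(i, k) \<in> set_coord i j f \<longleftrightarrow> k = j"
  by (auto simp: set_coord_def)

lemma set_coord_set_coord [simp]: "set_coord i k (set_coord i j f) = set_coord i k f"
  by (auto simp: set_coord_def)

lemma two_pow_Int: "f \<in> two_pow S \<Longrightarrow> Q \<subseteq> S \<Longrightarrow> f \<inter> Q \<times> UNIV \<in> two_pow Q"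
  by (auto simp: two_pow_iff)

lemma two_pow_Un:
  "g \<in> two_pow Q \<Longrightarrow> h \<in> two_pow (S - Q) \<Longrightarrow> Q \<subseteq> S \<Longrightarrow> g \<union> h \<in> two_pow S"
  unfolding two_pow_iff by blast

lemma set_coord_Int: "i \<in> Q \<Longrightarrow> set_coord i j f \<inter> Q \<times> UNIV = set_coord i j (f \<inter> Q \<times> UNIV)"
  by (auto simp: set_coord_def)

lemma set_coord_Int_out: "i \<notin> Q \<Longrightarrow> set_coord i j f \<inter> Q \<times> UNIV = f \<inter> Q \<times> UNIV"
  by (auto simp: set_coord_def)

lemma flip_coord_Int: "i \<in> Q \<Longrightarrow> flip_coord i f \<inter> Q \<times> UNIV = flip_coord i (f \<inter> Q \<times> UNIV)"
  by (simp add: flip_coord_def set_coord_Int)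

lemma flip_coord_Int_out: "i \<notin> Q \<Longrightarrow> flip_coord i f \<inter> Q \<times> UNIV = f \<inter> Q \<times> UNIV"
  by (simp add: flip_coord_def set_coord_Int_out)

lemma two_pow_not_in: "h \<in> two_pow T \<Longrightarrow> i \<notin> T \<Longrightarrow> (i, j) \<notin> h"
  by (auto dest: two_pow_in)

lemma set_coord_Un1: "h \<in> two_pow T \<Longrightarrow> i \<notin> T \<Longrightarrow> set_coord i j (g \<union> h) = set_coord i j g \<union> h"
  using two_pow_not_in[of h T i] by (auto simp: set_coord_def)

lemma set_coord_Un2: "g \<in> two_pow T \<Longrightarrow> i \<notin> T \<Longrightarrow> set_coord i j (g \<union> h) = g \<union> set_coord i j h"
  using two_pow_not_in[of g T i] by (auto simp: set_coord_def)

lemma flip_coord_Un1: "h \<in> two_pow T \<Longrightarrow> i \<notin> T \<Longrightarrow> flip_coord i (g \<union> h) = flip_coord i g \<union> h"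
  using two_pow_not_in[of h T i] by (simp add: flip_coord_def set_coord_Un1)

lemma flip_coord_Un2: "g \<in> two_pow T \<Longrightarrow> i \<notin> T \<Longrightarrow> flip_coord i (g \<union> h) = g \<union> flip_coord i h"
  using two_pow_not_in[of g T i] by (simp add: flip_coord_def set_coord_Un2)

lemma two_pow_Un_Int1: "g \<in> two_pow Q \<Longrightarrow> h \<in> two_pow (S - Q) \<Longrightarrow> (g \<union> h) \<inter> Q \<times> UNIV = g"
  by (auto dest: two_pow_in)

lemma two_pow_split: "f \<in> two_pow S \<Longrightarrow> f \<inter> Q \<times> UNIV \<union> f \<inter> (S - Q) \<times> UNIV = f"
  by (auto dest: two_pow_in)

lemma two_pow_insert: "g \<in> two_pow (S - {i}) \<Longrightarrow> i \<in> S \<Longrightarrow> j = 0 \<or> j = Suc 0 \<Longrightarrow> insert (i, j) g \<in> two_pow S"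
  by (auto simp: two_pow_iff)

lemma two_pow_remove: "f \<in> two_pow S \<Longrightarrow> f - {i} \<times> UNIV \<in> two_pow (S - {i})"
  by (auto simp: two_pow_iff)

section \<open>Cubes, their faces and composites\<close>

lemma cubes_in: "\<gamma> \<in> cubes S A \<Longrightarrow> f \<in> two_pow S \<Longrightarrow> \<gamma> f \<in> A"
  by (auto simp: cubes_def)

lemma restrict_in_cubes: "(\<And>f. f \<in> two_pow S \<Longrightarrow> u f \<in> A) \<Longrightarrow> restrict u (two_pow S) \<in> cubes S A"
  by (simp add: cubes_def)

lemma cubes_ext:
  "\<gamma> \<in> cubes S A \<Longrightarrow> \<delta> \<in> cubes S B \<Longrightarrow> (\<And>f. f \<in> two_pow S \<Longrightarrow> \<gamma> f = \<delta> f) \<Longrightarrow> \<gamma> = \<delta>"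
  by (auto simp: cubes_def intro: PiE_ext[of \<gamma> "two_pow S" "\<lambda>_. A \<union> B"])

lemma cube_face_apply:
  "g \<in> two_pow (S - {i}) \<Longrightarrow> cube_face S i j \<gamma> g = \<gamma> (insert (i, j) g)"
  by (simp add: cube_face_def)

text \<open>Every vertex of the face extends to a vertex over \<open>S\<close>, and overwriting
  direction \<open>i\<close> forgets which extension was chosen. Composability of two cubes can thus
  be tested on vertices of the full cube.\<close>

lemma cube_face_eq_iff:
  assumes "i \<in> S"
  shows "cube_face S i j \<gamma> = cube_face S i k \<delta> \<longleftrightarrow>
    (\<forall>f\<in>two_pow S. \<gamma> (set_coord i j f) = \<delta> (set_coord i k f))"
proof
  assume eq: "cube_face S i j \<gamma> = cube_face S i k \<delta>"
  show "\<forall>f\<in>two_pow S. \<gamma> (set_coord i j f) = \<delta> (set_coord i k f)"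
  proof
    fix f assume "f \<in> two_pow S"
    from fun_cong[OF eq, of "f - {i} \<times> UNIV"] two_pow_remove[OF this, of i]
    show "\<gamma> (set_coord i j f) = \<delta> (set_coord i k f)"
      by (simp add: cube_face_def set_coord_def)
  qed
next
  assume eq: "\<forall>f\<in>two_pow S. \<gamma> (set_coord i j f) = \<delta> (set_coord i k f)"
  show "cube_face S i j \<gamma> = cube_face S i k \<delta>"
    unfolding cube_face_def
  proof (rule restrict_ext)
    fix g assume g: "g \<in> two_pow (S - {i})"
    have "set_coord i l (insert (i, 0) g) = g \<union> {(i, l)}" for l
      using two_pow_not_in[OF g, of i] by (auto simp: set_coord_def)
    with eq two_pow_insert[OF g assms, of 0] show "\<gamma> (g \<union> {(i, j)}) = \<delta> (g \<union> {(i, k)})"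
      by fastforce
  qed
qed

lemma cube_refl_eq:
  assumes "i \<in> S" "j = 0 \<or> j = Suc 0"
  shows "cube_refl S i j \<gamma> = (\<lambda>f\<in>two_pow S. \<gamma> (set_coord i j f))"
  unfolding cube_refl_def glue1_def
proof (rule restrict_ext)
  fix f assume f: "f \<in> two_pow S"
  have "f - {(i, 0)} = f - {i} \<times> UNIV" if "(i, 0) \<in> f"
    using that two_pow_unique[OF f] by blast
  moreover have "f - {(i, 1)} = f - {i} \<times> UNIV" if "(i, 0) \<notin> f"
    using that two_pow_in[OF f, of i] by auto
  ultimately show "(if (i, 0) \<in> f then cube_face S i j \<gamma> (f - {(i, 0)}) else cube_face S i j \<gamma> (f - {(i, 1)}))
      = \<gamma> (set_coord i j f)"
    using two_pow_remove[OF f, of i] by (simp add: cube_face_def set_coord_def)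
qed

lemma cube_sym_eq:
  assumes "i \<in> S"
  shows "cube_sym S i \<gamma> = (\<lambda>f\<in>two_pow S. \<gamma> (flip_coord i f))"
  unfolding cube_sym_def glue1_def
proof (rule restrict_ext)
  fix f assume f: "f \<in> two_pow S"
  have "f - {(i, 0)} = f - {i} \<times> UNIV" if "(i, 0) \<in> f"
    using that two_pow_unique[OF f] by blast
  moreover have "f - {(i, 1)} = f - {i} \<times> UNIV" if "(i, 0) \<notin> f"
    using that two_pow_in[OF f, of i] by auto
  ultimately show "(if (i, 0) \<in> f then cube_face S i 1 \<gamma> (f - {(i, 0)}) else cube_face S i 0 \<gamma> (f - {(i, 1)}))
      = \<gamma> (flip_coord i f)"
    using two_pow_remove[OF f, of i] by (simp add: cube_face_def set_coord_def flip_coord_def)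
qed

lemma cube_eq_by_faces:
  assumes "\<gamma> \<in> cubes S A" "\<delta> \<in> cubes S B" "i \<in> S"
    and "cube_face S i 0 \<gamma> = cube_face S i 0 \<delta>" "cube_face S i 1 \<gamma> = cube_face S i 1 \<delta>"
  shows "\<gamma> = \<delta>"
proof (rule cubes_ext[OF assms(1,2)])
  fix f assume f: "f \<in> two_pow S"
  then show "\<gamma> f = \<delta> f"
    using assms(4,5) two_pow_coord[OF f assms(3)] set_coord_id[OF f, of i]
    unfolding cube_face_eq_iff[OF assms(3)] by (metis One_nat_def)
qed

text \<open>When face 1 of \<gamma> is face 0 of \<delta>, this is the cube that transitivity of
  \<open>face_rel\<close> demands. It is written as a total function; the matching condition is
  imposed only where composites are used.\<close>

definition cube_comp :: "nat set \<Rightarrow> nat \<Rightarrow> ((nat \<times> nat) set \<Rightarrow> 'a) \<Rightarrow> ((nat \<times> nat) set \<Rightarrow> 'a)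
    \<Rightarrow> ((nat \<times> nat) set \<Rightarrow> 'a)" where
  "cube_comp S i \<gamma> \<delta> = (\<lambda>f\<in>two_pow S. if (i, 0) \<in> f then \<gamma> f else \<delta> f)"

lemma cube_comp_faces:
  assumes "i \<in> S"
  shows "cube_face S i 0 (cube_comp S i \<gamma> \<delta>) = cube_face S i 0 \<gamma>"
    and "cube_face S i (Suc 0) (cube_comp S i \<gamma> \<delta>) = cube_face S i (Suc 0) \<delta>"
  using assms by (auto simp: cube_face_eq_iff cube_comp_def)

text \<open>Rephrases the definition as closure under maps of cubes. Transitivity becomes closure
  under \<open>cube_comp\<close>, so that each later verification amounts to commuting a
  construction with four kinds of operations.\<close>

lemma hd_congruenceI:
  assumes "R \<subseteq> cubes S A"
    and "\<And>f xs. length xs = ar f \<Longrightarrow> set xs \<subseteq> R \<Longrightarrow> pow_ops (two_pow S) F f xs \<in> R"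
    and "\<And>\<gamma> i j. \<gamma> \<in> R \<Longrightarrow> i \<in> S \<Longrightarrow> j = 0 \<or> j = Suc 0 \<Longrightarrow> (\<lambda>f\<in>two_pow S. \<gamma> (set_coord i j f)) \<in> R"
    and "\<And>\<gamma> i. \<gamma> \<in> R \<Longrightarrow> i \<in> S \<Longrightarrow> (\<lambda>f\<in>two_pow S. \<gamma> (flip_coord i f)) \<in> R"
    and comp: "\<And>\<gamma> \<delta> i. \<gamma> \<in> R \<Longrightarrow> \<delta> \<in> R \<Longrightarrow> i \<in> S \<Longrightarrow>
      (\<And>f. f \<in> two_pow S \<Longrightarrow> \<gamma> (set_coord i (Suc 0) f) = \<delta> (set_coord i 0 f)) \<Longrightarrow> cube_comp S i \<gamma> \<delta> \<in> R"
  shows "hd_congruence ar A F S R"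
proof -
  have "trans (face_rel S i R)" if i: "i \<in> S" for i
  proof (rule transI)
    fix x y z assume "(x, y) \<in> face_rel S i R" "(y, z) \<in> face_rel S i R"
    then obtain \<gamma> \<delta> where *: "\<gamma> \<in> R" "\<delta> \<in> R" "x = cube_face S i 0 \<gamma>" "y = cube_face S i 1 \<gamma>"
      "y = cube_face S i 0 \<delta>" "z = cube_face S i 1 \<delta>"
      by (auto simp: face_rel_def)
    then have "cube_comp S i \<gamma> \<delta> \<in> R"
      using i by (intro comp) (auto simp: cube_face_eq_iff)
    then show "(x, z) \<in> face_rel S i R"
      unfolding face_rel_def using * cube_comp_faces[OF i, of \<gamma> \<delta>]
      by (auto intro!: exI[of _ "cube_comp S i \<gamma> \<delta>"])
  qed
  then show ?thesis
    using assms(1-4)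
    by (auto simp: hd_congruence_def hd_tolerance_def subuniverse_def cube_refl_eq cube_sym_eq)
qed

lemma hd_congruenceD:
  assumes "hd_congruence ar A F S R"
  shows hd_congruence_cubes: "R \<subseteq> cubes S A"
    and hd_congruence_op: "length xs = ar f \<Longrightarrow> set xs \<subseteq> R \<Longrightarrow> pow_ops (two_pow S) F f xs \<in> R"
    and hd_congruence_refl: "\<gamma> \<in> R \<Longrightarrow> i \<in> S \<Longrightarrow> j = 0 \<or> j = Suc 0 \<Longrightarrow>
      (\<lambda>f\<in>two_pow S. \<gamma> (set_coord i j f)) \<in> R"
    and hd_congruence_sym: "\<gamma> \<in> R \<Longrightarrow> i \<in> S \<Longrightarrow> (\<lambda>f\<in>two_pow S. \<gamma> (flip_coord i f)) \<in> R"
    and hd_congruence_comp: "\<gamma> \<in> R \<Longrightarrow> \<delta> \<in> R \<Longrightarrow> i \<in> S \<Longrightarrow>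
      (\<And>f. f \<in> two_pow S \<Longrightarrow> \<gamma> (set_coord i (Suc 0) f) = \<delta> (set_coord i 0 f)) \<Longrightarrow> cube_comp S i \<gamma> \<delta> \<in> R"
proof -
  have tol: "hd_tolerance ar A F S R" using assms by (simp add: hd_congruence_def)
  show sub: "R \<subseteq> cubes S A" using tol by (simp add: hd_tolerance_def subuniverse_def)
  show "length xs = ar f \<Longrightarrow> set xs \<subseteq> R \<Longrightarrow> pow_ops (two_pow S) F f xs \<in> R"
    using tol by (simp add: hd_tolerance_def subuniverse_def)
  show "\<gamma> \<in> R \<Longrightarrow> i \<in> S \<Longrightarrow> j = 0 \<or> j = Suc 0 \<Longrightarrow> (\<lambda>f\<in>two_pow S. \<gamma> (set_coord i j f)) \<in> R"
    using tol cube_refl_eq[of i S j \<gamma>, symmetric] by (auto simp: hd_tolerance_def)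
  show "\<gamma> \<in> R \<Longrightarrow> i \<in> S \<Longrightarrow> (\<lambda>f\<in>two_pow S. \<gamma> (flip_coord i f)) \<in> R"
    using tol cube_sym_eq[of i S \<gamma>, symmetric] by (auto simp: hd_tolerance_def)
  assume \<gamma>: "\<gamma> \<in> R" and \<delta>: "\<delta> \<in> R" and i: "i \<in> S"
    and eq: "\<And>f. f \<in> two_pow S \<Longrightarrow> \<gamma> (set_coord i (Suc 0) f) = \<delta> (set_coord i 0 f)"
  have "cube_face S i 1 \<gamma> = cube_face S i 0 \<delta>" using i eq by (simp add: cube_face_eq_iff)
  then have "(cube_face S i 0 \<gamma>, cube_face S i 0 \<delta>) \<in> face_rel S i R"
    "(cube_face S i 0 \<delta>, cube_face S i 1 \<delta>) \<in> face_rel S i R"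
    using \<gamma> \<delta> by (force simp: face_rel_def)+
  moreover have "trans (face_rel S i R)" using assms i by (simp add: hd_congruence_def)
  ultimately have "(cube_face S i 0 \<gamma>, cube_face S i 1 \<delta>) \<in> face_rel S i R"
    by (meson transD)
  then obtain \<epsilon> where \<epsilon>: "\<epsilon> \<in> R" "cube_face S i 0 \<gamma> = cube_face S i 0 \<epsilon>"
    "cube_face S i 1 \<delta> = cube_face S i 1 \<epsilon>"
    by (auto simp: face_rel_def)
  \<comment> \<open>Transitivity provides only some \<epsilon> with the two outer faces. A cube is
    determined by a pair of opposite faces, so \<epsilon> is the composite.\<close>
  have "cube_comp S i \<gamma> \<delta> \<in> cubes S A"
    unfolding cube_comp_def using \<gamma> \<delta> sub by (intro restrict_in_cubes) (auto intro: cubes_in)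
  then have "cube_comp S i \<gamma> \<delta> = \<epsilon>"
    by (rule cube_eq_by_faces[where B = A and i = i]) (use \<epsilon> sub i in \<open>auto simp: cube_comp_faces\<close>)
  then show "cube_comp S i \<gamma> \<delta> \<in> R" using \<epsilon> by simp
qed

section \<open>Minimality of \<Delta>\<close>

lemma pow_ops_in_cubes:
  assumes "algebra ar A F" "length xs = ar f" "set xs \<subseteq> cubes S A"
  shows "pow_ops (two_pow S) F f xs \<in> cubes S A"
  unfolding pow_ops_def
proof (rule restrict_in_cubes)
  fix g assume g: "g \<in> two_pow S"
  show "F f (map (\<lambda>x. x g) xs) \<in> A"
    by (rule algebra_op[OF assms(1)]) (use assms g in \<open>auto intro: cubes_in\<close>)
qed

text \<open>Shows that the family intersected in \<open>Delta\<close> has a member among the sets of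
  cubes over \<open>A\<close>; without it, \<Delta> could not be bounded by
  \<open>cubes S A\<close>.\<close>

lemma hd_congruence_all:
  assumes "algebra ar A F"
  shows "hd_congruence ar A F S (cubes S A)"
  by (rule hd_congruenceI)
    (auto intro!: pow_ops_in_cubes[OF assms] restrict_in_cubes simp: cube_comp_def intro: cubes_in)

text \<open>The induction principle behind the inclusions below. A higher dimensional congruence is
  itself a subuniverse, so the generators suffice and \<open>M_gen\<close> never has to be
  computed.\<close>

lemma Delta_least:
  assumes R: "hd_congruence ar A F S R"
    and gen: "\<And>k x y. k \<in> S \<Longrightarrow> (x, y) \<in> \<theta> k \<Longrightarrow> cube_const S k x y \<in> R"
  shows "Delta ar A F S \<theta> \<subseteq> R"
proof -
  have "subuniverse ar (cubes S A) (pow_ops (two_pow S) F) R"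
    using R by (simp add: hd_congruence_def hd_tolerance_def)
  then have "M_gen ar A F S \<theta> \<subseteq> R" using gen unfolding M_gen_def by blast
  then show ?thesis using R unfolding Delta_def by blast
qed

lemma cube_const_in_Delta:
  "k \<in> S \<Longrightarrow> (x, y) \<in> \<theta> k \<Longrightarrow> cube_const S k x y \<in> Delta ar A F S \<theta>"
  unfolding Delta_def M_gen_def by blast

lemma hd_congruence_Delta:
  assumes alg: "algebra ar A F" and con: "\<forall>k\<in>S. congruence ar A F (\<theta> k)"
  shows "hd_congruence ar A F S (Delta ar A F S \<theta>)"
proof -
  define \<R> where "\<R> = {R. hd_congruence ar A F S R \<and> M_gen ar A F S \<theta> \<subseteq> R}"
  have D: "Delta ar A F S \<theta> = \<Inter>\<R>" by (simp add: Delta_def \<R>_def)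
  have hd: "hd_congruence ar A F S R" if "R \<in> \<R>" for R using that by (simp add: \<R>_def)
  have "cube_const S k x y \<in> cubes S A" if "k \<in> S" "(x, y) \<in> \<theta> k" for k x y
    unfolding cube_const_def using that con congruence_in[of ar A F "\<theta> k" x y]
    by (intro restrict_in_cubes) auto
  then have "Delta ar A F S \<theta> \<subseteq> cubes S A"
    by (rule Delta_least[OF hd_congruence_all[OF alg]])
  then show ?thesis
  proof (rule hd_congruenceI)
    fix \<gamma> \<delta> i assume "\<gamma> \<in> Delta ar A F S \<theta>" "\<delta> \<in> Delta ar A F S \<theta>" "i \<in> S"
      "\<And>f. f \<in> two_pow S \<Longrightarrow> \<gamma> (set_coord i (Suc 0) f) = \<delta> (set_coord i 0 f)"
    then show "cube_comp S i \<gamma> \<delta> \<in> Delta ar A F S \<theta>"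
      unfolding D using hd_congruence_comp[OF hd] by blast
  next
    fix f xs assume "length xs = ar f" "set xs \<subseteq> Delta ar A F S \<theta>"
    then show "pow_ops (two_pow S) F f xs \<in> Delta ar A F S \<theta>"
      unfolding D using hd_congruence_op[OF hd] by (simp add: le_Inf_iff)
  qed (unfold D, use hd_congruence_refl[OF hd] hd_congruence_sym[OF hd] in auto)
qed

text \<open>A constant cube is the generator \<open>cube_const S k x x\<close> for any direction
  \<open>k\<close>, by reflexivity of \<open>\<theta> k\<close>.\<close>

lemma const_in_Delta:
  assumes con: "\<forall>k\<in>S. congruence ar A F (\<theta> k)" and "S \<noteq> {}" "x \<in> A"
  shows "(\<lambda>f\<in>two_pow S. x) \<in> Delta ar A F S \<theta>"
proof -
  obtain k where k: "k \<in> S" using assms(2) by blast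
  then have "cube_const S k x x \<in> Delta ar A F S \<theta>"
    using con congruence_refl[OF _ assms(3)] by (intro cube_const_in_Delta) auto
  then show ?thesis by (simp add: cube_const_def)
qed

section \<open>Duplicates, slices and pointwise images of cubes in \<Delta>\<close>

definition cube_dup :: "nat set \<Rightarrow> nat set \<Rightarrow> ((nat \<times> nat) set \<Rightarrow> 'a) \<Rightarrow> ((nat \<times> nat) set \<Rightarrow> 'a)" where
  "cube_dup S S0 \<gamma> = (\<lambda>f\<in>two_pow S. \<gamma> (f \<inter> S0 \<times> UNIV))"

text \<open>A duplicate is degenerate in the directions outside \<open>S0\<close>. Duplication
  commutes with the basic operations and with reflection, symmetry and composition in directions of
  \<open>S0\<close>, so a preimage under it inherits all closure properties.\<close>

lemma hd_congruence_dup: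
  assumes alg: "algebra ar A F" and R: "hd_congruence ar A F S R" and S0: "S0 \<subseteq> S"
  shows "hd_congruence ar A F S0 {\<gamma> \<in> cubes S0 A. cube_dup S S0 \<gamma> \<in> R}" (is "hd_congruence ar A F S0 ?R0")
proof (rule hd_congruenceI)
  note I = two_pow_Int[OF _ S0]
  show "?R0 \<subseteq> cubes S0 A" by auto
  fix f xs assume xs: "length xs = ar f" "set xs \<subseteq> ?R0"
  have "cube_dup S S0 (pow_ops (two_pow S0) F f xs) = pow_ops (two_pow S) F f (map (cube_dup S S0) xs)"
    by (auto simp: cube_dup_def pow_ops_def I comp_def intro!: restrict_ext)
  also have "\<dots> \<in> R" using xs by (intro hd_congruence_op[OF R]) auto
  finally show "pow_ops (two_pow S0) F f xs \<in> ?R0"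
    using xs pow_ops_in_cubes[OF alg, of xs f S0] by auto
next
  note I = two_pow_Int[OF _ S0]
  fix \<gamma> i assume \<gamma>: "\<gamma> \<in> ?R0" and i: "i \<in> S0"
  then have iS: "i \<in> S" using S0 by auto
  {
    fix j :: nat assume j: "j = 0 \<or> j = Suc 0"
    have "cube_dup S S0 (\<lambda>f\<in>two_pow S0. \<gamma> (set_coord i j f)) = (\<lambda>f\<in>two_pow S. cube_dup S S0 \<gamma> (set_coord i j f))"
      using i iS j by (auto simp: cube_dup_def I set_coord_Int intro!: restrict_ext)
    also have "\<dots> \<in> R" using \<gamma> iS j by (intro hd_congruence_refl[OF R]) auto
    finally show "(\<lambda>f\<in>two_pow S0. \<gamma> (set_coord i j f)) \<in> ?R0"
      using \<gamma> i j by (auto intro!: restrict_in_cubes intro: cubes_in)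
  }
  have "cube_dup S S0 (\<lambda>f\<in>two_pow S0. \<gamma> (flip_coord i f)) = (\<lambda>f\<in>two_pow S. cube_dup S S0 \<gamma> (flip_coord i f))"
    using i iS by (auto simp: cube_dup_def I flip_coord_Int intro!: restrict_ext)
  also have "\<dots> \<in> R" using \<gamma> iS by (intro hd_congruence_sym[OF R]) auto
  finally show "(\<lambda>f\<in>two_pow S0. \<gamma> (flip_coord i f)) \<in> ?R0"
    using \<gamma> i by (auto intro!: restrict_in_cubes intro: cubes_in)
  fix \<delta> assume \<delta>: "\<delta> \<in> ?R0"
    and eq: "\<And>f. f \<in> two_pow S0 \<Longrightarrow> \<gamma> (set_coord i (Suc 0) f) = \<delta> (set_coord i 0 f)"
  have "cube_dup S S0 (cube_comp S0 i \<gamma> \<delta>) = cube_comp S i (cube_dup S S0 \<gamma>) (cube_dup S S0 \<delta>)"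
    using i by (auto simp: cube_dup_def cube_comp_def I intro!: restrict_ext)
  also have "\<dots> \<in> R"
    using \<gamma> \<delta> iS i by (intro hd_congruence_comp[OF R]) (auto simp: cube_dup_def set_coord_Int I eq)
  finally show "cube_comp S0 i \<gamma> \<delta> \<in> ?R0"
    using \<gamma> \<delta> by (auto simp: cube_comp_def intro!: restrict_in_cubes intro: cubes_in)
qed

text \<open>By minimality, since duplication takes the generator in direction \<open>k\<close> over
  \<open>S0\<close> to the generator in direction \<open>k\<close> over \<open>S\<close>.\<close>

lemma Delta_dup:
  assumes alg: "algebra ar A F" and con: "\<forall>k\<in>S. congruence ar A F (\<theta> k)"
    and S0: "S0 \<subseteq> S" and \<gamma>: "\<gamma> \<in> Delta ar A F S0 \<theta>"
  shows "cube_dup S S0 \<gamma> \<in> Delta ar A F S \<theta>"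
proof -
  have "Delta ar A F S0 \<theta> \<subseteq> {\<gamma> \<in> cubes S0 A. cube_dup S S0 \<gamma> \<in> Delta ar A F S \<theta>}"
  proof (rule Delta_least[OF hd_congruence_dup[OF alg hd_congruence_Delta[OF alg con] S0]])
    fix k x y assume k: "k \<in> S0" "(x, y) \<in> \<theta> k"
    then have "cube_dup S S0 (cube_const S0 k x y) = cube_const S k x y"
      by (auto simp: cube_dup_def cube_const_def two_pow_Int[OF _ S0] intro!: restrict_ext)
    moreover have "cube_const S k x y \<in> Delta ar A F S \<theta>"
      using k S0 by (intro cube_const_in_Delta) auto
    moreover have "x \<in> A" "y \<in> A" using k S0 con congruence_in[of ar A F "\<theta> k" x y] by auto
    then have "cube_const S0 k x y \<in> cubes S0 A"
      by (auto simp: cube_const_def intro!: restrict_in_cubes)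
    ultimately show "cube_const S0 k x y \<in> {\<gamma> \<in> cubes S0 A. cube_dup S S0 \<gamma> \<in> Delta ar A F S \<theta>}"
      by simp
  qed
  then show ?thesis using \<gamma> by blast
qed

text \<open>Minimality has to be applied to all slices at once: a reflection or symmetry in a
  direction outside \<open>S0\<close> turns one slice into another. A composite in such a direction
  has slices that are slices of one of its two parts, and a generator in such a direction has
  constant slices.\<close>

lemma Delta_slice:
  fixes A :: "'a set"
  assumes alg: "algebra ar A F" and con: "\<forall>k\<in>S. congruence ar A F (\<theta> k)"
    and S0: "S0 \<subseteq> S" "S0 \<noteq> {}" and \<gamma>: "\<gamma> \<in> Delta ar A F S \<theta>" and h: "h \<in> two_pow (S - S0)"
  shows "(\<lambda>g\<in>two_pow S0. \<gamma> (g \<union> h)) \<in> Delta ar A F S0 \<theta>"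
proof -
  define sl where "sl h \<gamma> = (\<lambda>g\<in>two_pow S0. \<gamma> (g \<union> h))" for h :: "(nat \<times> nat) set" and \<gamma> :: "(nat \<times> nat) set \<Rightarrow> 'a"
  define D where "D = Delta ar A F S0 \<theta>"
  define R where "R = {\<gamma> \<in> cubes S A. \<forall>h\<in>two_pow (S - S0). sl h \<gamma> \<in> D}"
  note U = two_pow_Un[OF _ _ S0(1)]
  have con0: "\<forall>k\<in>S0. congruence ar A F (\<theta> k)" using con S0 by auto
  have D: "hd_congruence ar A F S0 D" unfolding D_def by (rule hd_congruence_Delta[OF alg con0])
  have "hd_congruence ar A F S R"
  proof (rule hd_congruenceI)
    show "R \<subseteq> cubes S A" by (auto simp: R_def)
    fix f xs assume xs: "length xs = ar f" "set xs \<subseteq> R"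
    have "sl h (pow_ops (two_pow S) F f xs) \<in> D" if h: "h \<in> two_pow (S - S0)" for h
    proof -
      have "sl h (pow_ops (two_pow S) F f xs) = pow_ops (two_pow S0) F f (map (sl h) xs)"
        using h by (auto simp: sl_def pow_ops_def U comp_def intro!: restrict_ext)
      also have "\<dots> \<in> D" using xs h by (intro hd_congruence_op[OF D]) (auto simp: R_def)
      finally show ?thesis .
    qed
    then show "pow_ops (two_pow S) F f xs \<in> R"
      using xs pow_ops_in_cubes[OF alg, of xs f S] by (auto simp: R_def)
  next
    fix \<gamma> i assume \<gamma>: "\<gamma> \<in> R" and i: "i \<in> S"
    {
      fix j :: nat assume j: "j = 0 \<or> j = Suc 0"
      have "sl h (\<lambda>f\<in>two_pow S. \<gamma> (set_coord i j f)) \<in> D" if h: "h \<in> two_pow (S - S0)" for h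
      proof (cases "i \<in> S0")
        case True
        then have "sl h (\<lambda>f\<in>two_pow S. \<gamma> (set_coord i j f)) = (\<lambda>g\<in>two_pow S0. sl h \<gamma> (set_coord i j g))"
          using h j by (auto simp: sl_def U set_coord_Un1 intro!: restrict_ext)
        also have "\<dots> \<in> D" using \<gamma> h True j by (intro hd_congruence_refl[OF D]) (auto simp: R_def)
        finally show ?thesis .
      next
        case False
        then have "sl h (\<lambda>f\<in>two_pow S. \<gamma> (set_coord i j f)) = sl (set_coord i j h) \<gamma>"
          using h by (auto simp: sl_def U set_coord_Un2 intro!: restrict_ext)
        then show ?thesis using \<gamma> h i j False by (auto simp: R_def)
      qed
      then show "(\<lambda>f\<in>two_pow S. \<gamma> (set_coord i j f)) \<in> R"
        using \<gamma> i j by (auto simp: R_def intro!: restrict_in_cubes intro: cubes_in)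
    }
    have "sl h (\<lambda>f\<in>two_pow S. \<gamma> (flip_coord i f)) \<in> D" if h: "h \<in> two_pow (S - S0)" for h
    proof (cases "i \<in> S0")
      case True
      then have "sl h (\<lambda>f\<in>two_pow S. \<gamma> (flip_coord i f)) = (\<lambda>g\<in>two_pow S0. sl h \<gamma> (flip_coord i g))"
        using h by (auto simp: sl_def U flip_coord_Un1 intro!: restrict_ext)
      also have "\<dots> \<in> D" using \<gamma> h True by (intro hd_congruence_sym[OF D]) (auto simp: R_def)
      finally show ?thesis .
    next
      case False
      then have "sl h (\<lambda>f\<in>two_pow S. \<gamma> (flip_coord i f)) = sl (flip_coord i h) \<gamma>"
        using h by (auto simp: sl_def U flip_coord_Un2 intro!: restrict_ext)
      then show ?thesis using \<gamma> h i False by (auto simp: R_def)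
    qed
    then show "(\<lambda>f\<in>two_pow S. \<gamma> (flip_coord i f)) \<in> R"
      using \<gamma> i by (auto simp: R_def intro!: restrict_in_cubes intro: cubes_in)
    fix \<delta> assume \<delta>: "\<delta> \<in> R"
      and eq: "\<And>f. f \<in> two_pow S \<Longrightarrow> \<gamma> (set_coord i (Suc 0) f) = \<delta> (set_coord i 0 f)"
    have "sl h (cube_comp S i \<gamma> \<delta>) \<in> D" if h: "h \<in> two_pow (S - S0)" for h
    proof (cases "i \<in> S0")
      case True
      then have nh: "(i, 0) \<notin> h" using two_pow_not_in[OF h] by auto
      have "sl h (cube_comp S i \<gamma> \<delta>) = cube_comp S0 i (sl h \<gamma>) (sl h \<delta>)"
        using h nh by (auto simp: sl_def cube_comp_def U intro!: restrict_ext)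
      also have "\<dots> \<in> D"
      proof (rule hd_congruence_comp[OF D])
        fix g assume g: "g \<in> two_pow S0"
        show "sl h \<gamma> (set_coord i (Suc 0) g) = sl h \<delta> (set_coord i 0 g)"
          using eq[OF U[OF g h]] True g h by (simp add: sl_def set_coord_Un1)
      qed (use \<gamma> \<delta> h True in \<open>auto simp: R_def\<close>)
      finally show ?thesis .
    next
      case False
      then have "sl h (cube_comp S i \<gamma> \<delta>) = (if (i, 0) \<in> h then sl h \<gamma> else sl h \<delta>)"
        using h by (auto simp: sl_def cube_comp_def U dest: two_pow_not_in intro!: restrict_ext)
      then show ?thesis using \<gamma> \<delta> h by (auto simp: R_def)
    qed
    then show "cube_comp S i \<gamma> \<delta> \<in> R"
      using \<gamma> \<delta> by (auto simp: R_def cube_comp_def intro!: restrict_in_cubes intro: cubes_in)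
  qed
  then have "Delta ar A F S \<theta> \<subseteq> R"
  proof (rule Delta_least)
    fix k x y assume k: "k \<in> S" "(x, y) \<in> \<theta> k"
    then have xy: "x \<in> A" "y \<in> A" using con congruence_in[of ar A F "\<theta> k" x y] by auto
    have "sl h (cube_const S k x y) \<in> D" if h: "h \<in> two_pow (S - S0)" for h
    proof (cases "k \<in> S0")
      case True
      then have "sl h (cube_const S k x y) = cube_const S0 k x y"
        using h by (auto simp: sl_def cube_const_def U dest: two_pow_not_in intro!: restrict_ext)
      then show ?thesis using True k by (simp add: D_def cube_const_in_Delta)
    next
      case False
      then have "sl h (cube_const S k x y) = (\<lambda>g\<in>two_pow S0. if (k, 0) \<in> h then x else y)"
        using h by (auto simp: sl_def cube_const_def U dest: two_pow_not_in intro!: restrict_ext)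
      then show ?thesis
        using const_in_Delta[OF con0 S0(2)] xy by (cases "(k, 0) \<in> h") (auto simp: D_def)
    qed
    then show "cube_const S k x y \<in> R"
      using xy by (auto simp: R_def cube_const_def intro!: restrict_in_cubes)
  qed
  then show ?thesis using \<gamma> h by (auto simp: R_def sl_def D_def)
qed

text \<open>Applying an endomorphism at every vertex commutes with all operations on cubes and keeps
  generators generators. This makes reflections and symmetries inside the vertices of
  \<open>Q\<close>-cubes accessible, where minimality over \<open>Q\<close> alone does not see
  them.\<close>

lemma Delta_map:
  fixes B :: "'b set"
  assumes alg: "algebra ar B G" and con: "\<forall>k\<in>Q. congruence ar B G (\<alpha> k)"
    and \<phi>: "\<And>b. b \<in> B \<Longrightarrow> \<phi> b \<in> B"
    and hom: "\<And>f xs. length xs = ar f \<Longrightarrow> set xs \<subseteq> B \<Longrightarrow> \<phi> (G f xs) = G f (map \<phi> xs)"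
    and pres: "\<And>k x y. k \<in> Q \<Longrightarrow> (x, y) \<in> \<alpha> k \<Longrightarrow> (\<phi> x, \<phi> y) \<in> \<alpha> k"
    and \<Gamma>: "\<Gamma> \<in> Delta ar B G Q \<alpha>"
  shows "(\<lambda>g\<in>two_pow Q. \<phi> (\<Gamma> g)) \<in> Delta ar B G Q \<alpha>"
proof -
  define mp where "mp \<Gamma> = (\<lambda>g\<in>two_pow Q. \<phi> (\<Gamma> g))" for \<Gamma> :: "(nat \<times> nat) set \<Rightarrow> 'b"
  define D where "D = Delta ar B G Q \<alpha>"
  define R where "R = {\<Gamma> \<in> cubes Q B. mp \<Gamma> \<in> D}"
  have D: "hd_congruence ar B G Q D" unfolding D_def by (rule hd_congruence_Delta[OF alg con])
  have "hd_congruence ar B G Q R"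
  proof (rule hd_congruenceI)
    show "R \<subseteq> cubes Q B" by (auto simp: R_def)
    fix f xs assume xs: "length xs = ar f" "set xs \<subseteq> R"
    have "\<phi> (G f (map (\<lambda>x. x g) xs)) = G f (map (\<lambda>x. \<phi> (x g)) xs)" if "g \<in> two_pow Q" for g
      using xs that hom[of "map (\<lambda>x. x g) xs" f] by (force simp: comp_def R_def intro: cubes_in)
    then have "mp (pow_ops (two_pow Q) G f xs) = pow_ops (two_pow Q) G f (map mp xs)"
      by (auto simp: mp_def pow_ops_def comp_def intro!: restrict_ext)
    also have "\<dots> \<in> D" using xs by (intro hd_congruence_op[OF D]) (auto simp: R_def)
    finally show "pow_ops (two_pow Q) G f xs \<in> R"
      using xs pow_ops_in_cubes[OF alg, of xs f Q] by (auto simp: R_def)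
  next
    fix \<gamma> i assume \<gamma>: "\<gamma> \<in> R" and i: "i \<in> Q"
    {
      fix j :: nat assume j: "j = 0 \<or> j = Suc 0"
      have "mp (\<lambda>f\<in>two_pow Q. \<gamma> (set_coord i j f)) = (\<lambda>f\<in>two_pow Q. mp \<gamma> (set_coord i j f))"
        using i j by (auto simp: mp_def intro!: restrict_ext)
      also have "\<dots> \<in> D" using \<gamma> i j by (intro hd_congruence_refl[OF D]) (auto simp: R_def)
      finally show "(\<lambda>f\<in>two_pow Q. \<gamma> (set_coord i j f)) \<in> R"
        using \<gamma> i j by (auto simp: R_def intro!: restrict_in_cubes intro: cubes_in)
    }
    have "mp (\<lambda>f\<in>two_pow Q. \<gamma> (flip_coord i f)) = (\<lambda>f\<in>two_pow Q. mp \<gamma> (flip_coord i f))"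
      using i by (auto simp: mp_def intro!: restrict_ext)
    also have "\<dots> \<in> D" using \<gamma> i by (intro hd_congruence_sym[OF D]) (auto simp: R_def)
    finally show "(\<lambda>f\<in>two_pow Q. \<gamma> (flip_coord i f)) \<in> R"
      using \<gamma> i by (auto simp: R_def intro!: restrict_in_cubes intro: cubes_in)
    fix \<delta> assume \<delta>: "\<delta> \<in> R"
      and eq: "\<And>f. f \<in> two_pow Q \<Longrightarrow> \<gamma> (set_coord i (Suc 0) f) = \<delta> (set_coord i 0 f)"
    have "mp (cube_comp Q i \<gamma> \<delta>) = cube_comp Q i (mp \<gamma>) (mp \<delta>)"
      by (auto simp: mp_def cube_comp_def intro!: restrict_ext)
    also have "\<dots> \<in> D"
      using \<gamma> \<delta> i by (intro hd_congruence_comp[OF D]) (auto simp: R_def mp_def eq)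
    finally show "cube_comp Q i \<gamma> \<delta> \<in> R"
      using \<gamma> \<delta> by (auto simp: R_def cube_comp_def intro!: restrict_in_cubes intro: cubes_in)
  qed
  then have "Delta ar B G Q \<alpha> \<subseteq> R"
  proof (rule Delta_least)
    fix k x y assume k: "k \<in> Q" "(x, y) \<in> \<alpha> k"
    then have xy: "x \<in> B" "y \<in> B" using con congruence_in[of ar B G "\<alpha> k" x y] by auto
    have "mp (cube_const Q k x y) = cube_const Q k (\<phi> x) (\<phi> y)"
      by (auto simp: mp_def cube_const_def intro!: restrict_ext)
    also have "\<dots> \<in> D" unfolding D_def using k pres by (intro cube_const_in_Delta) auto
    finally show "cube_const Q k x y \<in> R"
      using xy by (auto simp: R_def cube_const_def intro!: restrict_in_cubes)
  qed
  then show ?thesis using \<Gamma> by (auto simp: R_def mp_def D_def)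
qed

subsection \<open>Completing rectangles\<close>

lemma cube_dup_cube_face:
  assumes "i \<in> S" "j = 0 \<or> j = Suc 0"
  shows "cube_dup S (S - {i}) (cube_face S i j \<gamma>) = (\<lambda>f\<in>two_pow S. \<gamma> (set_coord i j f))"
  unfolding cube_dup_def
proof (rule restrict_ext)
  fix f assume f: "f \<in> two_pow S"
  have "f \<inter> (S - {i}) \<times> UNIV = f - {i} \<times> UNIV" using two_pow_in[OF f] by auto
  then show "cube_face S i j \<gamma> (f \<inter> (S - {i}) \<times> UNIV) = \<gamma> (set_coord i j f)"
    using two_pow_remove[OF f, of i] by (simp add: cube_face_apply set_coord_def)
qed

lemma cube_face_cube_dup:
  assumes "i \<in> S" "j = 0 \<or> j = Suc 0" "c \<in> cubes (S - {i}) A"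
  shows "cube_face S i j (cube_dup S (S - {i}) c) = c"
proof (rule cubes_ext[OF _ assms(3)])
  fix g assume g: "g \<in> two_pow (S - {i})"
  have "insert (i, j) g \<inter> (S - {i}) \<times> UNIV = g" using two_pow_in[OF g] by auto
  then show "cube_face S i j (cube_dup S (S - {i}) c) g = c g"
    using two_pow_insert[OF g assms(1,2)] g by (simp add: cube_face_apply cube_dup_def)
qed (auto simp: cube_face_def cubes_def)

lemma cube_face_pow_ops:
  assumes "i \<in> S" "j = 0 \<or> j = Suc 0"
  shows "cube_face S i j (pow_ops (two_pow S) F f xs) = pow_ops (two_pow (S - {i})) F f (map (cube_face S i j) xs)"
  using two_pow_insert[OF _ assms]
  by (auto simp: cube_face_def pow_ops_def comp_def intro!: restrict_ext)

lemma cube_face_in_cubes: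
  assumes "i \<in> S" "j = 0 \<or> j = Suc 0" "\<gamma> \<in> cubes S A"
  shows "cube_face S i j \<gamma> \<in> cubes (S - {i}) A"
  using two_pow_insert[OF _ assms(1,2)] cubes_in[OF assms(3)]
  by (auto simp: cube_face_def intro!: restrict_in_cubes)

text \<open>The carrier is the set of all faces of members of \<open>R\<close> in direction
  \<open>i\<close>: duplicating a face yields a reflection, and conversely a cube is a face of its
  own duplicate. Duplicates also witness reflexivity, while symmetry and transitivity are the
  closure properties of \<open>R\<close> in direction \<open>i\<close>.\<close>

lemma congruence_face_rel:
  assumes R: "hd_congruence ar A F S R" and i: "i \<in> S"
  shows "congruence ar {c \<in> cubes (S - {i}) A. cube_dup S (S - {i}) c \<in> R}
    (pow_ops (two_pow (S - {i})) F) (face_rel S i R)" (is "congruence ar ?C ?G ?\<rho>")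
proof (rule congruenceI)
  have face: "cube_face S i j \<gamma> \<in> ?C" if "\<gamma> \<in> R" "j = 0 \<or> j = Suc 0" for \<gamma> j
    using that i hd_congruence_cubes[OF R] hd_congruence_refl[OF R]
    by (auto simp: cube_dup_cube_face intro!: cube_face_in_cubes)
  show "x \<in> ?C \<and> y \<in> ?C" if "(x, y) \<in> ?\<rho>" for x y
  proof -
    from that obtain \<gamma> where "\<gamma> \<in> R" "x = cube_face S i 0 \<gamma>" "y = cube_face S i (Suc 0) \<gamma>"
      by (auto simp: face_rel_def)
    then show ?thesis using face[of \<gamma> 0] face[of \<gamma> "Suc 0"] by simp
  qed
  show "(x, x) \<in> ?\<rho>" if x: "x \<in> ?C" for x
  proof -
    have "cube_face S i 0 (cube_dup S (S - {i}) x) = x" "cube_face S i 1 (cube_dup S (S - {i}) x) = x"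
      using x i cube_face_cube_dup[of i S _ x A] by auto
    then show ?thesis unfolding face_rel_def using x by force
  qed
  show "(y, x) \<in> ?\<rho>" if xy: "(x, y) \<in> ?\<rho>" for x y
  proof -
    obtain \<gamma> where \<gamma>: "\<gamma> \<in> R" "x = cube_face S i 0 \<gamma>" "y = cube_face S i 1 \<gamma>"
      using xy by (auto simp: face_rel_def)
    let ?\<delta> = "\<lambda>f\<in>two_pow S. \<gamma> (flip_coord i f)"
    have "?\<delta> \<in> R" using hd_congruence_sym[OF R] \<gamma> i by auto
    moreover have "y = cube_face S i 0 ?\<delta>" "x = cube_face S i 1 ?\<delta>"
      using \<gamma> i by (auto simp: cube_face_eq_iff flip_coord_def)
    ultimately show ?thesis unfolding face_rel_def by blast
  qed
  show "(x, z) \<in> ?\<rho>" if "(x, y) \<in> ?\<rho>" "(y, z) \<in> ?\<rho>" for x y z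
    using that R i by (auto simp: hd_congruence_def dest: transD)
  show "(?G f xs, ?G f ys) \<in> ?\<rho>"
    if len: "length xs = ar f" "length ys = ar f"
      and rel: "\<And>n. n < ar f \<Longrightarrow> (xs ! n, ys ! n) \<in> ?\<rho>" for f xs ys
  proof -
    have "\<forall>n. \<exists>\<gamma>. n < ar f \<longrightarrow> \<gamma> \<in> R \<and> xs ! n = cube_face S i 0 \<gamma> \<and> ys ! n = cube_face S i 1 \<gamma>"
      using rel unfolding face_rel_def by blast
    then obtain \<gamma> where \<gamma>: "\<And>n. n < ar f \<Longrightarrow>
        \<gamma> n \<in> R \<and> xs ! n = cube_face S i 0 (\<gamma> n) \<and> ys ! n = cube_face S i 1 (\<gamma> n)"
      by metis
    define zs where "zs = map \<gamma> [0..<ar f]"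
    have "xs = map (cube_face S i 0) zs" "ys = map (cube_face S i 1) zs"
      using len \<gamma> by (auto simp: zs_def intro!: nth_equalityI)
    then have "?G f xs = cube_face S i 0 (pow_ops (two_pow S) F f zs)"
      "?G f ys = cube_face S i 1 (pow_ops (two_pow S) F f zs)"
      using i by (simp_all add: cube_face_pow_ops)
    moreover have "pow_ops (two_pow S) F f zs \<in> R"
      using \<gamma> by (intro hd_congruence_op[OF R]) (auto simp: zs_def)
    ultimately show ?thesis unfolding face_rel_def by blast
  qed
qed

lemma hd_congruence_algebra:
  "hd_congruence ar A F S R \<Longrightarrow> algebra ar R (pow_ops (two_pow S) F)"
  by (simp add: algebra_def hd_congruence_op)

lemma congruence_pointwise:
  assumes "algebra ar C (pow_ops I G)" and \<eta>: "congruence ar B G \<eta>"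
    and sub: "\<And>c g. c \<in> C \<Longrightarrow> g \<in> I \<Longrightarrow> c g \<in> B"
  shows "congruence ar C (pow_ops I G) {(c, d). c \<in> C \<and> d \<in> C \<and> (\<forall>g\<in>I. (c g, d g) \<in> \<eta>)}"
    (is "congruence ar C ?G ?\<theta>")
proof (rule congruenceI)
  note D = congruenceD[OF \<eta>]
  fix f xs ys assume len: "length xs = ar f" "length ys = ar f"
    and rel: "\<And>n. n < ar f \<Longrightarrow> (xs ! n, ys ! n) \<in> ?\<theta>"
  have "set xs \<subseteq> C" "set ys \<subseteq> C" using rel len by (auto simp: in_set_conv_nth)
  then have "?G f xs \<in> C" "?G f ys \<in> C" using algebra_op[OF assms(1)] len by auto
  moreover have "(?G f xs g, ?G f ys g) \<in> \<eta>" if "g \<in> I" for g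
    using that len rel by (auto simp: pow_ops_def intro!: D(5))
  ultimately show "(?G f xs, ?G f ys) \<in> ?\<theta>" by simp
next
  fix x y z assume "(x, y) \<in> ?\<theta>" "(y, z) \<in> ?\<theta>"
  then show "(x, z) \<in> ?\<theta>" using congruence_trans[OF \<eta>] by blast
qed (use sub congruence_refl[OF \<eta>] congruence_sym[OF \<eta>] in auto)

text \<open>Coordinates are read at each vertex. Finite index sets stay finite, so shifting remains
  available on every algebra of faces in the induction below.\<close>

lemma separated_by_cubes:
  assumes sep: "separated_by ar A F B G I e" and alg: "algebra ar C (pow_ops (two_pow Q) G)"
    and sub: "C \<subseteq> cubes Q B"
  shows "separated_by ar A F C (pow_ops (two_pow Q) G) (two_pow Q \<times> I) (\<lambda>(g, k) c. e k (c g))"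
  unfolding separated_by_def
proof (intro conjI ballI allI impI)
  have in_B: "c g \<in> B" if "c \<in> C" "g \<in> two_pow Q" for c g
    using that sub cubes_in by blast
  show "(case p of (g, k) \<Rightarrow> \<lambda>c. e k (c g)) c \<in> A" if "p \<in> two_pow Q \<times> I" "c \<in> C" for p c
    using that in_B sep by (auto simp: separated_by_def)
  show "(case p of (g, k) \<Rightarrow> \<lambda>c. e k (c g)) (pow_ops (two_pow Q) G f xs) =
      F f (map (case p of (g, k) \<Rightarrow> \<lambda>c. e k (c g)) xs)"
    if p: "p \<in> two_pow Q \<times> I" and xs: "length xs = ar f" "set xs \<subseteq> C" for p f xs
  proof -
    obtain g k where gk: "p = (g, k)" "g \<in> two_pow Q" "k \<in> I" using p by auto
    have "set (map (\<lambda>x. x g) xs) \<subseteq> B" using xs gk in_B by auto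
    then have "e k (G f (map (\<lambda>x. x g) xs)) = F f (map (e k) (map (\<lambda>x. x g) xs))"
      using sep gk xs unfolding separated_by_def by (metis length_map)
    then show ?thesis using gk by (simp add: pow_ops_def comp_def)
  qed
  show "x = y"
    if x: "x \<in> C" and y: "y \<in> C" and eq: "\<forall>p\<in>two_pow Q \<times> I. (case p of (g, k) \<Rightarrow> \<lambda>c. e k (c g)) x =
      (case p of (g, k) \<Rightarrow> \<lambda>c. e k (c g)) y" for x y
  proof (rule cubes_ext)
    fix g assume g: "g \<in> two_pow Q"
    have "e k (x g) = e k (y g)" if "k \<in> I" for k using eq[THEN bspec, of "(g, k)"] g that by simp
    then show "x g = y g" using sep in_B x y g unfolding separated_by_def by blast
  qed (use x y sub in auto)
qed (rule alg)

text \<open>Induction on the dimension: the relation \<open>face_rel\<close> in one direction is a congruence on the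
  algebra of faces, which by induction already contains the faces of \<open>\<Gamma>\<^sub>1\<close>.\<close>
lemma hd_congruence_rectangle:
  fixes B :: "'b set"
  assumes cm: "in_cm_variety ar A F" and finI: "finite I" and sep: "separated_by ar A F B G I e"
    and \<eta>0: "congruence ar B G \<eta>\<^sub>0" and \<eta>1: "congruence ar B G \<eta>\<^sub>1" and disj: "\<eta>\<^sub>0 \<inter> \<eta>\<^sub>1 \<subseteq> Id"
    and finQ: "finite Q" and R: "hd_congruence ar B G Q R"
    and const: "\<And>b. b \<in> B \<Longrightarrow> (\<lambda>g\<in>two_pow Q. b) \<in> R"
    and \<Gamma>: "\<Gamma>\<^sub>1 \<in> cubes Q B" "\<Gamma>\<^sub>2 \<in> R" "\<Gamma>\<^sub>3 \<in> R" "\<Gamma>\<^sub>4 \<in> R"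
    and rect: "\<And>g. g \<in> two_pow Q \<Longrightarrow> (\<Gamma>\<^sub>1 g, \<Gamma>\<^sub>2 g) \<in> \<eta>\<^sub>0 \<and> (\<Gamma>\<^sub>2 g, \<Gamma>\<^sub>3 g) \<in> \<eta>\<^sub>1 \<and>
      (\<Gamma>\<^sub>4 g, \<Gamma>\<^sub>3 g) \<in> \<eta>\<^sub>0 \<and> (\<Gamma>\<^sub>1 g, \<Gamma>\<^sub>4 g) \<in> \<eta>\<^sub>1"
  shows "\<Gamma>\<^sub>1 \<in> R"
  using finQ R const \<Gamma> rect
proof (induction Q arbitrary: R \<Gamma>\<^sub>1 \<Gamma>\<^sub>2 \<Gamma>\<^sub>3 \<Gamma>\<^sub>4 rule: finite_induct)
  case empty
  \<comment> \<open>A cube of dimension 0 is a single element of \<open>B\<close>. The assumption on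
    constant cubes settles this case and is carried through the induction for it.\<close>
  have "\<Gamma>\<^sub>1 = (\<lambda>g\<in>two_pow {}. \<Gamma>\<^sub>1 {})"
    by (rule cubes_ext[OF empty.prems(3)]) (use cubes_in[OF empty.prems(3)] in \<open>auto simp: two_pow_empty cubes_def\<close>)
  moreover have "\<Gamma>\<^sub>1 {} \<in> B" using cubes_in[OF empty.prems(3)] by (simp add: two_pow_empty)
  ultimately show ?case using empty.prems(2) by metis
next
  case (insert i Q)
  define S where "S = insert i Q"
  have i: "i \<in> S" and Q: "S - {i} = Q" "Q \<subseteq> S" using insert.hyps by (auto simp: S_def)
  note prems = insert.prems[folded S_def]
  have algB: "algebra ar B G" using sep by (simp add: separated_by_def)
  \<comment> \<open>The faces of \<open>R\<close> in direction \<open>i\<close>, described by their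
    duplicates; in this form \<open>C\<close> is at once a higher dimensional congruence in the
    remaining directions.\<close>
  define C where "C = {c \<in> cubes Q B. cube_dup S Q c \<in> R}"
  have hdC: "hd_congruence ar B G Q C"
    unfolding C_def by (rule hd_congruence_dup[OF algB prems(1) Q(2)])
  have constC: "(\<lambda>g\<in>two_pow Q. b) \<in> C" if "b \<in> B" for b
  proof -
    have "cube_dup S Q (\<lambda>g\<in>two_pow Q. b) = (\<lambda>g\<in>two_pow S. b)"
      by (auto simp: cube_dup_def two_pow_Int[OF _ Q(2)] intro!: restrict_ext)
    with prems(2)[OF that] have "cube_dup S Q (\<lambda>g\<in>two_pow Q. b) \<in> R" by (simp only:)
    moreover have "(\<lambda>g\<in>two_pow Q. b) \<in> cubes Q B" using that by (rule restrict_in_cubes)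
    ultimately show ?thesis unfolding C_def by blast
  qed
  have \<rho>: "congruence ar C (pow_ops (two_pow Q) G) (face_rel S i R)"
    using congruence_face_rel[OF prems(1) i] by (simp add: C_def Q)
  have face_rel: "(cube_face S i 0 \<gamma>, cube_face S i 1 \<gamma>) \<in> face_rel S i R" if "\<gamma> \<in> R" for \<gamma>
    using that by (auto simp: face_rel_def)
  have faceC: "cube_face S i j \<gamma> \<in> C" if "\<gamma> \<in> R" "j = 0 \<or> j = Suc 0" for \<gamma> j
    using congruence_in[OF \<rho> face_rel[OF that(1)]] that(2) by auto
  have face_apply: "cube_face S i j \<gamma> g = \<gamma> (insert (i, j) g)" "insert (i, j) g \<in> two_pow S"
    if "g \<in> two_pow Q" "j = 0 \<or> j = Suc 0" for g j and \<gamma> :: "(nat \<times> nat) set \<Rightarrow> 'b"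
    using that cube_face_apply[of g S i j \<gamma>] two_pow_insert[of g S i j] i by (auto simp: Q)
  have face1: "cube_face S i j \<Gamma>\<^sub>1 \<in> C" if j: "j = 0 \<or> j = Suc 0" for j
  proof (rule insert.IH[OF hdC constC])
    show "cube_face S i j \<Gamma>\<^sub>1 \<in> cubes Q B"
      using cube_face_in_cubes[OF i j prems(3)] by (simp add: Q)
    show "cube_face S i j \<Gamma>\<^sub>2 \<in> C" "cube_face S i j \<Gamma>\<^sub>3 \<in> C" "cube_face S i j \<Gamma>\<^sub>4 \<in> C"
      using prems faceC j by auto
    fix g assume "g \<in> two_pow Q"
    then show "(cube_face S i j \<Gamma>\<^sub>1 g, cube_face S i j \<Gamma>\<^sub>2 g) \<in> \<eta>\<^sub>0 \<and>
      (cube_face S i j \<Gamma>\<^sub>2 g, cube_face S i j \<Gamma>\<^sub>3 g) \<in> \<eta>\<^sub>1 \<and>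
      (cube_face S i j \<Gamma>\<^sub>4 g, cube_face S i j \<Gamma>\<^sub>3 g) \<in> \<eta>\<^sub>0 \<and>
      (cube_face S i j \<Gamma>\<^sub>1 g, cube_face S i j \<Gamma>\<^sub>4 g) \<in> \<eta>\<^sub>1"
      using j face_apply prems(7)[of "insert (i, j) g"] by simp
  qed
  define pw where "pw \<eta> = {(c, d). c \<in> C \<and> d \<in> C \<and> (\<forall>g\<in>two_pow Q. (c g, d g) \<in> \<eta>)}" for \<eta>
  have algC: "algebra ar C (pow_ops (two_pow Q) G)" by (rule hd_congruence_algebra[OF hdC])
  have subC: "C \<subseteq> cubes Q B" by (auto simp: C_def)
  have pw: "congruence ar C (pow_ops (two_pow Q) G) (pw \<eta>)" if "congruence ar B G \<eta>" for \<eta>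
    unfolding pw_def by (rule congruence_pointwise[OF algC that]) (use subC cubes_in in blast)
  \<comment> \<open>The two kernels meet trivially at every vertex, so the pointwise relations meet
    in equality and reflexivity of \<open>face_rel\<close> suffices.\<close>
  have "pw \<eta>\<^sub>0 \<inter> pw \<eta>\<^sub>1 \<subseteq> face_rel S i R"
  proof
    fix p assume "p \<in> pw \<eta>\<^sub>0 \<inter> pw \<eta>\<^sub>1"
    then obtain c d where p: "p = (c, d)" "c \<in> C" "d \<in> C"
      and "\<forall>g\<in>two_pow Q. (c g, d g) \<in> \<eta>\<^sub>0 \<inter> \<eta>\<^sub>1" by (auto simp: pw_def)
    then have "c g = d g" if "g \<in> two_pow Q" for g using that disj by blast
    then have "c = d" using p subC by (intro cubes_ext[of c Q B d B]) auto
    then show "p \<in> face_rel S i R" using p congruence_refl[OF \<rho>] by simp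
  qed
  moreover have "(cube_face S i j \<gamma>, cube_face S i j \<delta>) \<in> pw \<eta>"
    if "cube_face S i j \<gamma> \<in> C" "cube_face S i j \<delta> \<in> C" "j = 0 \<or> j = Suc 0"
      "\<And>g. g \<in> two_pow S \<Longrightarrow> (\<gamma> g, \<delta> g) \<in> \<eta>" for j \<gamma> \<delta> \<eta>
    using that face_apply by (auto simp: pw_def)
  note pwI = this
  have "finite (two_pow Q \<times> I)" using finI finite_two_pow[OF insert.hyps(1)] by simp
  \<comment> \<open>The faces 0 of the four cubes form the first rectangle and the faces 1 the
    second. Membership of \<open>\<Gamma>\<^sub>2\<close>, \<open>\<Gamma>\<^sub>3\<close>,
    \<open>\<Gamma>\<^sub>4\<close> in \<open>R\<close> relates three pairs of corners.\<close>
  from rectangle_transfer[OF cm this separated_by_cubes[OF sep algC subC] \<rho> pw[OF \<eta>0] pw[OF \<eta>1] calculation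
    pwI[of 0] pwI[of 0] pwI[of 0] pwI[of 0] pwI[of 1] pwI[of 1] pwI[of 1] pwI[of 1]
    face_rel[OF prems(4)] face_rel[OF prems(5)] face_rel[OF prems(6)]]
  have "(cube_face S i 0 \<Gamma>\<^sub>1, cube_face S i 1 \<Gamma>\<^sub>1) \<in> face_rel S i R"
    using face1 faceC[OF prems(4)] faceC[OF prems(5)] faceC[OF prems(6)] prems(7) by simp
  then obtain \<gamma> where \<gamma>: "\<gamma> \<in> R" "cube_face S i 0 \<Gamma>\<^sub>1 = cube_face S i 0 \<gamma>" "cube_face S i 1 \<Gamma>\<^sub>1 = cube_face S i 1 \<gamma>"
    by (auto simp: face_rel_def)
  then have "\<Gamma>\<^sub>1 = \<gamma>"
    using hd_congruence_cubes[OF prems(1)] by (intro cube_eq_by_faces[OF prems(3) _ i, of \<gamma> B]) auto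
  then show ?case using \<gamma> by simp
qed

text \<open>A slice of a duplicate gives back the original cube, so \<open>Delta_slice\<close>
  reverses \<open>Delta_dup\<close>. This identifies \<open>B\<close> with the carrier of the
  congruences \<alpha>_i.\<close>

lemma Delta_eq_dup:
  assumes alg: "algebra ar A F" and con: "\<forall>k\<in>S. congruence ar A F (\<theta> k)"
    and S0: "S0 \<subseteq> S" "S0 \<noteq> {}"
  shows "Delta ar A F S0 \<theta> = {c \<in> cubes S0 A. cube_dup S S0 c \<in> Delta ar A F S \<theta>}"
proof (intro equalityI subsetI)
  fix c assume c: "c \<in> Delta ar A F S0 \<theta>"
  have "\<forall>k\<in>S0. congruence ar A F (\<theta> k)" using con S0 by auto
  then show "c \<in> {c \<in> cubes S0 A. cube_dup S S0 c \<in> Delta ar A F S \<theta>}"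
    using c hd_congruence_cubes[OF hd_congruence_Delta[OF alg]] Delta_dup[OF alg con S0(1) c] by blast
next
  fix c assume "c \<in> {c \<in> cubes S0 A. cube_dup S S0 c \<in> Delta ar A F S \<theta>}"
  then have c: "c \<in> cubes S0 A" "cube_dup S S0 c \<in> Delta ar A F S \<theta>" by auto
  \<comment> \<open>Any vertex would do, since a duplicate has equal slices; the zero vertex is
    merely explicit.\<close>
  define h where "h = (S - S0) \<times> {0 :: nat}"
  have h: "h \<in> two_pow (S - S0)" by (auto simp: two_pow_iff h_def)
  have "(\<lambda>g\<in>two_pow S0. cube_dup S S0 c (g \<union> h)) = c"
  proof (rule cubes_ext[OF _ c(1)])
    show "(\<lambda>g\<in>two_pow S0. cube_dup S S0 c (g \<union> h)) \<in> cubes S0 UNIV" by (simp add: restrict_in_cubes)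
    fix g assume g: "g \<in> two_pow S0"
    then show "(\<lambda>g\<in>two_pow S0. cube_dup S S0 c (g \<union> h)) g = c g"
      using two_pow_Un[OF g h S0(1)] two_pow_Un_Int1[OF g h] by (simp add: cube_dup_def)
  qed
  then show "c \<in> Delta ar A F S0 \<theta>" using Delta_slice[OF alg con S0 c(2) h] by simp
qed

subsection \<open>Cutting and gluing\<close>

text \<open>Two applications of minimality: to the cubes over \<open>A\<close> whose cut lies in
  \<Delta>_B, and to the \<open>Q\<close>-cubes over \<open>B\<close> whose glued cube lies in
  \<Delta>. The first set has to be closed in all directions of \<open>S\<close>, the second only in
  those of \<open>Q\<close>.\<close>

lemma Delta_eq_glue_Delta:
  fixes A :: "'a set"
  assumes alg: "algebra ar A F" and cm: "in_cm_variety ar A F" and finS: "finite S"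
    and con: "\<forall>k\<in>S. congruence ar A F (\<theta> k)"
    and QS: "Q \<subseteq> S" and Qne: "Q \<noteq> {}" and QneS: "Q \<noteq> S"
  defines "T \<equiv> S - Q"
  defines "B \<equiv> Delta ar A F T \<theta>" and "FB \<equiv> pow_ops (two_pow T) F"
    and "\<alpha> \<equiv> \<lambda>i. face_rel (insert i T) i (Delta ar A F (insert i T) \<theta>)"
  shows "\<forall>i\<in>Q. congruence ar B FB (\<alpha> i)"
    and "Delta ar A F S \<theta> = cube_glue S Q ` Delta ar B FB Q \<alpha>"
proof -
  have T: "T \<subseteq> S" "T \<noteq> {}" "\<And>i. i \<in> T \<Longrightarrow> i \<notin> Q" using QS QneS by (auto simp: T_def)
  have finT: "finite T" and finQ: "finite Q" using finS QS by (auto simp: T_def intro: finite_subset)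
  have con_sub: "\<forall>k\<in>S'. congruence ar A F (\<theta> k)" if "S' \<subseteq> S" for S' using con that by auto
  have iT: "insert i T \<subseteq> S" "i \<notin> T" "insert i T - {i} = T" if "i \<in> Q" for i
    using that QS by (auto simp: T_def)
  have hd_iT: "hd_congruence ar A F (insert i T) (Delta ar A F (insert i T) \<theta>)" if "i \<in> Q" for i
    by (rule hd_congruence_Delta[OF alg con_sub[OF iT(1)[OF that]]])
  have hdB: "hd_congruence ar A F T B"
    unfolding B_def by (rule hd_congruence_Delta[OF alg con_sub[OF T(1)]])
  have algB: "algebra ar B FB" unfolding FB_def by (rule hd_congruence_algebra[OF hdB])
  have subB: "B \<subseteq> cubes T A" by (rule hd_congruence_cubes[OF hdB])
  show \<alpha>_con: "\<forall>i\<in>Q. congruence ar B FB (\<alpha> i)"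
  proof
    fix i assume i: "i \<in> Q"
    have "B = {c \<in> cubes T A. cube_dup (insert i T) T c \<in> Delta ar A F (insert i T) \<theta>}"
      unfolding B_def by (rule Delta_eq_dup[OF alg con_sub[OF iT(1)[OF i]]]) (use T in auto)
    then show "congruence ar B FB (\<alpha> i)"
      using congruence_face_rel[OF hd_iT[OF i] insertI1] by (simp add: iT[OF i] FB_def \<alpha>_def)
  qed
  define D where "D = Delta ar B FB Q \<alpha>"
  have hdD: "hd_congruence ar B FB Q D" unfolding D_def by (rule hd_congruence_Delta[OF algB \<alpha>_con])
  have constD: "(\<lambda>g\<in>two_pow Q. b) \<in> D" if "b \<in> B" for b
    unfolding D_def by (rule const_in_Delta[OF \<alpha>_con Qne that])
  have in_B: "\<Gamma> g \<in> B" if "\<Gamma> \<in> D" "g \<in> two_pow Q" for \<Gamma> g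
    using that hd_congruence_cubes[OF hdD] cubes_in by blast
  note U = two_pow_Un[of _ Q _ S, folded T_def, OF _ _ QS]
  \<comment> \<open>A vertex map \<sigma> on \<open>T\<close> induces the endomorphism of
    \<open>B\<close> that composes with \<sigma>. The last two conditions on \<sigma> make it
    preserve \<open>\<alpha> i\<close>: there the same \<sigma> acts on vertices over
    \<open>insert i T\<close> and must leave coordinate \<open>i\<close> alone.\<close>
  have reindex: "(\<lambda>g\<in>two_pow Q. \<lambda>h\<in>two_pow T. \<Gamma> g (\<sigma> h)) \<in> D"
    if \<Gamma>: "\<Gamma> \<in> D" and \<sigma>: "\<And>h. h \<in> two_pow T \<Longrightarrow> \<sigma> h \<in> two_pow T"
      and \<sigma>B: "\<And>b. b \<in> B \<Longrightarrow> (\<lambda>h\<in>two_pow T. b (\<sigma> h)) \<in> B"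
      and \<sigma>D: "\<And>i \<gamma>. i \<in> Q \<Longrightarrow> \<gamma> \<in> Delta ar A F (insert i T) \<theta> \<Longrightarrow>
        (\<lambda>f\<in>two_pow (insert i T). \<gamma> (\<sigma> f)) \<in> Delta ar A F (insert i T) \<theta>"
      and \<sigma>i: "\<And>i j h. i \<in> Q \<Longrightarrow> \<sigma> (insert (i, j) h) = insert (i, j) (\<sigma> h)"
    for \<Gamma> and \<sigma> :: "(nat \<times> nat) set \<Rightarrow> (nat \<times> nat) set"
    unfolding D_def
  proof (rule Delta_map[OF algB \<alpha>_con, where \<phi> = "\<lambda>b. \<lambda>h\<in>two_pow T. b (\<sigma> h)"])
    show "(\<lambda>h\<in>two_pow T. b (\<sigma> h)) \<in> B" if "b \<in> B" for b by (rule \<sigma>B[OF that])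
    show "(\<lambda>h\<in>two_pow T. FB f xs (\<sigma> h)) = FB f (map (\<lambda>b. \<lambda>h\<in>two_pow T. b (\<sigma> h)) xs)" for f xs
      by (auto simp: FB_def pow_ops_def comp_def \<sigma> intro!: restrict_ext)
    show "\<Gamma> \<in> Delta ar B FB Q \<alpha>" using \<Gamma> by (simp add: D_def)
    fix k x y assume k: "k \<in> Q" and "(x, y) \<in> \<alpha> k"
    then obtain \<gamma> where \<gamma>: "\<gamma> \<in> Delta ar A F (insert k T) \<theta>"
      "x = cube_face (insert k T) k 0 \<gamma>" "y = cube_face (insert k T) k 1 \<gamma>"
      by (auto simp: \<alpha>_def face_rel_def)
    let ?\<delta> = "\<lambda>f\<in>two_pow (insert k T). \<gamma> (\<sigma> f)"
    have "(\<lambda>h\<in>two_pow T. cube_face (insert k T) k j \<gamma> (\<sigma> h)) = cube_face (insert k T) k j ?\<delta>"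
      if j: "j = 0 \<or> j = Suc 0" for j
      using two_pow_insert[of _ "insert k T" k j] j
      by (auto simp: cube_face_def iT[OF k] \<sigma> \<sigma>i[OF k] intro!: restrict_ext)
    then show "(\<lambda>h\<in>two_pow T. x (\<sigma> h), \<lambda>h\<in>two_pow T. y (\<sigma> h)) \<in> \<alpha> k"
      using \<sigma>D[OF k \<gamma>(1)] \<gamma>(2,3) unfolding \<alpha>_def face_rel_def by auto
  qed
  have sepB: "separated_by ar A F B FB (two_pow T) (\<lambda>h b. b h)"
    unfolding separated_by_def
  proof (intro conjI ballI allI impI)
    show "x = y" if "x \<in> B" "y \<in> B" "\<forall>h\<in>two_pow T. x h = y h" for x y
      using that subB by (intro cubes_ext[of x T A y A]) auto
  qed (use algB subB in \<open>auto simp: FB_def pow_ops_def intro: cubes_in\<close>)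
  define X where "X = {\<gamma> \<in> cubes S A. cube_cut S Q \<gamma> \<in> D}"
  have cut_apply: "cube_cut S Q \<gamma> = (\<lambda>g\<in>two_pow Q. \<lambda>h\<in>two_pow T. \<gamma> (g \<union> h))" for \<gamma> :: "(nat \<times> nat) set \<Rightarrow> 'a"
    by (simp add: cube_cut_def T_def)
  have out: "i \<in> Q \<Longrightarrow> i \<notin> T" for i by (simp add: T_def)
  \<comment> \<open>After cutting, a direction in \<open>Q\<close> acts on the outer vertex and a
    direction in \<open>T\<close> on the inner one.\<close>
  have set1: "set_coord i j (g \<union> h) = set_coord i j g \<union> h" "flip_coord i (g \<union> h) = flip_coord i g \<union> h"
    "(i, 0) \<in> g \<union> h \<longleftrightarrow> (i, 0) \<in> g" if "i \<in> Q" "h \<in> two_pow T" for i j g h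
    using that out by (auto simp: set_coord_Un1 flip_coord_Un1 dest: two_pow_not_in)
  have set2: "set_coord i j (g \<union> h) = g \<union> set_coord i j h" "flip_coord i (g \<union> h) = g \<union> flip_coord i h"
    "(i, 0) \<in> g \<union> h \<longleftrightarrow> (i, 0) \<in> h" if "i \<in> T" "g \<in> two_pow Q" for i j g h
    using that T(3) by (auto simp: set_coord_Un2 flip_coord_Un2 dest: two_pow_not_in)
  have hdX: "hd_congruence ar A F S X"
  proof (rule hd_congruenceI)
    show "X \<subseteq> cubes S A" by (auto simp: X_def)
    fix f xs assume xs: "length xs = ar f" "set xs \<subseteq> X"
    have "cube_cut S Q (pow_ops (two_pow S) F f xs) = pow_ops (two_pow Q) FB f (map (cube_cut S Q) xs)"
      by (auto simp: cut_apply pow_ops_def FB_def U comp_def intro!: restrict_ext)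
    also have "\<dots> \<in> D" using xs by (intro hd_congruence_op[OF hdD]) (auto simp: X_def)
    finally show "pow_ops (two_pow S) F f xs \<in> X"
      using xs pow_ops_in_cubes[OF alg, of xs f S] by (auto simp: X_def)
  next
    fix \<gamma> i assume \<gamma>: "\<gamma> \<in> X" and i: "i \<in> S"
    then consider (Q) "i \<in> Q" | (T) "i \<in> T" by (auto simp: T_def)
    note i_cases = this
    have cut\<gamma>: "cube_cut S Q \<gamma> \<in> D" using \<gamma> by (simp add: X_def)
    \<comment> \<open>Besides closure under reflection, this supplies the third corner of the
      rectangle below.\<close>
    have reflT: "(\<lambda>g\<in>two_pow Q. \<lambda>h\<in>two_pow T. \<Gamma> g (set_coord i j h)) \<in> D"
      if "\<Gamma> \<in> D" "i \<in> T" "j = 0 \<or> j = Suc 0" for \<Gamma> j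
    proof (rule reindex[OF that(1)])
      show "set_coord i j (insert (i', j') h) = insert (i', j') (set_coord i j h)" if "i' \<in> Q" for i' j' h
        using that \<open>i \<in> T\<close> out by (auto simp: set_coord_def)
    qed (use that hd_congruence_refl[OF hdB] hd_congruence_refl[OF hd_iT] in auto)
    have symT: "(\<lambda>g\<in>two_pow Q. \<lambda>h\<in>two_pow T. \<Gamma> g (flip_coord i h)) \<in> D"
      if "\<Gamma> \<in> D" "i \<in> T" for \<Gamma>
    proof (rule reindex[OF that(1)])
      show "flip_coord i (insert (i', j') h) = insert (i', j') (flip_coord i h)" if "i' \<in> Q" for i' j' h
        using that \<open>i \<in> T\<close> out by (auto simp: flip_coord_def set_coord_def)
    qed (use that hd_congruence_sym[OF hdB] hd_congruence_sym[OF hd_iT] in auto)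
    {
      fix j :: nat assume j: "j = 0 \<or> j = Suc 0"
      have "cube_cut S Q (\<lambda>f\<in>two_pow S. \<gamma> (set_coord i j f)) \<in> D"
        using i_cases
      proof cases
        case Q
        then have "cube_cut S Q (\<lambda>f\<in>two_pow S. \<gamma> (set_coord i j f)) =
            (\<lambda>g\<in>two_pow Q. cube_cut S Q \<gamma> (set_coord i j g))"
          using j by (auto simp: cut_apply U set1 intro!: restrict_ext)
        then show ?thesis using hd_congruence_refl[OF hdD cut\<gamma> Q j] by simp
      next
        case T
        then have "cube_cut S Q (\<lambda>f\<in>two_pow S. \<gamma> (set_coord i j f)) =
            (\<lambda>g\<in>two_pow Q. \<lambda>h\<in>two_pow T. cube_cut S Q \<gamma> g (set_coord i j h))"
          using j by (auto simp: cut_apply U set2 intro!: restrict_ext)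
        then show ?thesis using reflT[OF cut\<gamma> T j] by simp
      qed
      then show "(\<lambda>f\<in>two_pow S. \<gamma> (set_coord i j f)) \<in> X"
        using \<gamma> i j by (auto simp: X_def intro!: restrict_in_cubes intro: cubes_in)
    }
    have "cube_cut S Q (\<lambda>f\<in>two_pow S. \<gamma> (flip_coord i f)) \<in> D"
      using i_cases
    proof cases
      case Q
      then have "cube_cut S Q (\<lambda>f\<in>two_pow S. \<gamma> (flip_coord i f)) =
          (\<lambda>g\<in>two_pow Q. cube_cut S Q \<gamma> (flip_coord i g))"
        by (auto simp: cut_apply U set1 intro!: restrict_ext)
      then show ?thesis using hd_congruence_sym[OF hdD cut\<gamma> Q] by simp
    next
      case T
      then have "cube_cut S Q (\<lambda>f\<in>two_pow S. \<gamma> (flip_coord i f)) =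
          (\<lambda>g\<in>two_pow Q. \<lambda>h\<in>two_pow T. cube_cut S Q \<gamma> g (flip_coord i h))"
        by (auto simp: cut_apply U set2 intro!: restrict_ext)
      then show ?thesis using symT[OF cut\<gamma> T] by simp
    qed
    then show "(\<lambda>f\<in>two_pow S. \<gamma> (flip_coord i f)) \<in> X"
      using \<gamma> i by (auto simp: X_def intro!: restrict_in_cubes intro: cubes_in)
    fix \<delta> assume \<delta>: "\<delta> \<in> X"
      and eq: "\<And>f. f \<in> two_pow S \<Longrightarrow> \<gamma> (set_coord i (Suc 0) f) = \<delta> (set_coord i 0 f)"
    have cut\<delta>: "cube_cut S Q \<delta> \<in> D" using \<delta> by (simp add: X_def)
    have "cube_cut S Q (cube_comp S i \<gamma> \<delta>) \<in> D"
      using i_cases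
    proof cases
      case Q
      then have "cube_cut S Q (cube_comp S i \<gamma> \<delta>) = cube_comp Q i (cube_cut S Q \<gamma>) (cube_cut S Q \<delta>)"
        by (auto simp: cut_apply cube_comp_def U set1(3) simp del: Un_iff intro!: restrict_ext)
      also have "\<dots> \<in> D"
      proof (rule hd_congruence_comp[OF hdD cut\<gamma> cut\<delta> Q])
        fix g assume g: "g \<in> two_pow Q"
        have "\<gamma> (set_coord i (Suc 0) g \<union> h) = \<delta> (set_coord i 0 g \<union> h)" if "h \<in> two_pow T" for h
          using eq[OF U[OF g that]] by (simp add: set1[OF Q that])
        then show "cube_cut S Q \<gamma> (set_coord i (Suc 0) g) = cube_cut S Q \<delta> (set_coord i 0 g)"
          using g Q by (auto simp: cut_apply intro!: restrict_ext)
      qed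
      finally show ?thesis .
    next
      case T
      \<comment> \<open>The kernel of the face map in direction \<open>i\<close>, with the face
        tested on full vertices.\<close>
      define \<eta> where "\<eta> j = {(b, c). b \<in> B \<and> c \<in> B \<and>
        (\<forall>h\<in>two_pow T. b (set_coord i j h) = c (set_coord i j h))}" for j :: nat
      have \<eta>: "congruence ar B FB (\<eta> j)" if j: "j = 0 \<or> j = Suc 0" for j
      proof (rule congruenceI)
        fix f xs ys assume len: "length xs = ar f" "length ys = ar f"
          and rel: "\<And>n. n < ar f \<Longrightarrow> (xs ! n, ys ! n) \<in> \<eta> j"
        have "set xs \<subseteq> B" "set ys \<subseteq> B" using rel len by (auto simp: in_set_conv_nth \<eta>_def)
        then have "FB f xs \<in> B" "FB f ys \<in> B" using algebra_op[OF algB] len by auto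
        moreover have "map (\<lambda>x. x (set_coord i j h)) xs = map (\<lambda>x. x (set_coord i j h)) ys"
          if "h \<in> two_pow T" for h
          using that rel len by (intro nth_equalityI) (auto simp: \<eta>_def)
        ultimately show "(FB f xs, FB f ys) \<in> \<eta> j" using T j by (auto simp: \<eta>_def FB_def pow_ops_def)
      qed (auto simp: \<eta>_def)
      have "\<eta> 0 \<inter> \<eta> (Suc 0) \<subseteq> Id"
      proof
        fix p assume "p \<in> \<eta> 0 \<inter> \<eta> (Suc 0)"
        then obtain b c where p: "p = (b, c)" "b \<in> B" "c \<in> B"
          and e: "\<forall>h\<in>two_pow T. b (set_coord i 0 h) = c (set_coord i 0 h)"
            "\<forall>h\<in>two_pow T. b (set_coord i (Suc 0) h) = c (set_coord i (Suc 0) h)"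
          by (auto simp: \<eta>_def)
        have "b h = c h" if h: "h \<in> two_pow T" for h
          using e h two_pow_coord[OF h T] set_coord_id[OF h] by metis
        then show "p \<in> Id" using p subB cubes_ext[of b T A c A] by auto
      qed
      \<comment> \<open>The corners are the cuts of the composite, of \<gamma> and of \<delta>, with
        the reflection of \<gamma> onto its face 1 as third corner. That face is also face 0 of
        \<delta>, which gives the edge between the last two.\<close>
      note rect = hd_congruence_rectangle[OF cm finite_two_pow[OF finT] sepB \<eta> \<eta> this finQ hdD constD
          _ cut\<gamma> reflT[OF cut\<gamma> T, of "Suc 0"] cut\<delta>]
      \<comment> \<open>At a single vertex of \<open>Q\<close>, closure of \<open>B\<close> under
        composition suffices; this places the unknown corner in \<open>cubes Q B\<close>.\<close>
      have comp_B: "cube_cut S Q (cube_comp S i \<gamma> \<delta>) g \<in> B" if g: "g \<in> two_pow Q" for g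
      proof -
        have "cube_cut S Q (cube_comp S i \<gamma> \<delta>) g = cube_comp T i (cube_cut S Q \<gamma> g) (cube_cut S Q \<delta> g)"
          using g T by (auto simp: cut_apply cube_comp_def U set2(3) simp del: Un_iff intro!: restrict_ext)
        also have "\<dots> \<in> B"
        proof (rule hd_congruence_comp[OF hdB in_B[OF cut\<gamma> g] in_B[OF cut\<delta> g] T])
          fix h assume h: "h \<in> two_pow T"
          show "cube_cut S Q \<gamma> g (set_coord i (Suc 0) h) = cube_cut S Q \<delta> g (set_coord i 0 h)"
            using eq[OF U[OF g h]] g h T by (simp add: cut_apply set2)
        qed
        finally show ?thesis .
      qed
      show ?thesis
      proof (rule rect)
        show "cube_cut S Q (cube_comp S i \<gamma> \<delta>) \<in> cubes Q B"
          using comp_B by (auto simp: cut_apply intro!: restrict_in_cubes)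
        fix g assume g: "g \<in> two_pow Q"
        have eq': "\<gamma> (g \<union> set_coord i (Suc 0) h) = \<delta> (g \<union> set_coord i 0 h)" if "h \<in> two_pow T" for h
          using eq[OF U[OF g that]] by (simp add: set2[OF T g])
        have mem: "(i, 0) \<in> g \<union> h \<longleftrightarrow> (i, 0) \<in> h" for h by (rule set2(3)[OF T g])
        let ?\<Gamma>3 = "\<lambda>g\<in>two_pow Q. \<lambda>h\<in>two_pow T. cube_cut S Q \<gamma> g (set_coord i (Suc 0) h)"
        have B: "cube_cut S Q (cube_comp S i \<gamma> \<delta>) g \<in> B" "cube_cut S Q \<gamma> g \<in> B" "cube_cut S Q \<delta> g \<in> B" "?\<Gamma>3 g \<in> B"
          using comp_B[OF g] in_B[OF cut\<gamma> g] in_B[OF cut\<delta> g] in_B[OF reflT[OF cut\<gamma> T, of "Suc 0"] g] by auto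
        show "(cube_cut S Q (cube_comp S i \<gamma> \<delta>) g, cube_cut S Q \<gamma> g) \<in> \<eta> 0 \<and>
          (cube_cut S Q \<gamma> g, ?\<Gamma>3 g) \<in> \<eta> (Suc 0) \<and> (cube_cut S Q \<delta> g, ?\<Gamma>3 g) \<in> \<eta> 0 \<and>
          (cube_cut S Q (cube_comp S i \<gamma> \<delta>) g, cube_cut S Q \<delta> g) \<in> \<eta> (Suc 0)"
          unfolding \<eta>_def mem_Collect_eq prod.case using B g T
          by (simp add: cut_apply cube_comp_def U mem eq' del: Un_iff)
      qed auto
    qed
    then show "cube_comp S i \<gamma> \<delta> \<in> X"
      using \<gamma> \<delta> by (auto simp: X_def cube_comp_def intro!: restrict_in_cubes intro: cubes_in)
  qed
  have "Delta ar A F S \<theta> \<subseteq> X"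
  proof (rule Delta_least[OF hdX])
    fix k x y assume k: "k \<in> S" "(x, y) \<in> \<theta> k"
    then have xy: "x \<in> A" "y \<in> A" using con congruence_in[of ar A F "\<theta> k" x y] by auto
    have "cube_cut S Q (cube_const S k x y) \<in> D"
    proof (cases "k \<in> Q")
      case True
      have "cube_cut S Q (cube_const S k x y) = cube_const Q k (\<lambda>h\<in>two_pow T. x) (\<lambda>h\<in>two_pow T. y)"
        using True by (auto simp: cut_apply cube_const_def U set1(3) simp del: Un_iff intro!: restrict_ext)
      \<comment> \<open>Related elements of \<open>A\<close>, spread as constant cubes over
        \<open>T\<close>, are the two faces of a generator over \<open>insert k T\<close>.\<close>
      moreover have "((\<lambda>h\<in>two_pow T. x), (\<lambda>h\<in>two_pow T. y)) \<in> \<alpha> k"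
      proof -
        have "(\<lambda>h\<in>two_pow T. x) = cube_face (insert k T) k 0 (cube_const (insert k T) k x y)"
          "(\<lambda>h\<in>two_pow T. y) = cube_face (insert k T) k 1 (cube_const (insert k T) k x y)"
          using iT[OF True] two_pow_insert[of _ "insert k T" k]
          by (auto simp: cube_face_def cube_const_def dest: two_pow_not_in intro!: restrict_ext)
        moreover have "cube_const (insert k T) k x y \<in> Delta ar A F (insert k T) \<theta>"
          using k by (intro cube_const_in_Delta) auto
        ultimately show ?thesis unfolding \<alpha>_def face_rel_def by blast
      qed
      ultimately show ?thesis using True by (simp add: D_def cube_const_in_Delta)
    next
      case False
      then have kT: "k \<in> T" using k by (simp add: T_def)
      have "cube_cut S Q (cube_const S k x y) = (\<lambda>g\<in>two_pow Q. cube_const T k x y)"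
        using kT by (auto simp: cut_apply cube_const_def U set2(3) simp del: Un_iff intro!: restrict_ext)
      moreover have "cube_const T k x y \<in> B" unfolding B_def using kT k(2) by (rule cube_const_in_Delta)
      ultimately show ?thesis using constD by simp
    qed
    then show "cube_const S k x y \<in> X"
      using xy by (auto simp: X_def cube_const_def intro!: restrict_in_cubes)
  qed
  \<comment> \<open>Gluing undoes cutting, so a cube whose cut lies in \<open>D\<close> is in the
    image of \<open>D\<close>.\<close>
  moreover have "cube_glue S Q (cube_cut S Q \<gamma>) = \<gamma>" if \<gamma>: "\<gamma> \<in> cubes S A" for \<gamma>
  proof (rule cubes_ext[OF _ \<gamma>])
    show "cube_glue S Q (cube_cut S Q \<gamma>) \<in> cubes S UNIV" by (simp add: cube_glue_def restrict_in_cubes)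
    fix f assume f: "f \<in> two_pow S"
    then show "cube_glue S Q (cube_cut S Q \<gamma>) f = \<gamma> f"
      using two_pow_split[OF f, of Q] two_pow_Int[OF f QS] two_pow_Int[OF f T(1)]
      by (simp add: cube_glue_def cut_apply T_def)
  qed
  ultimately have "Delta ar A F S \<theta> \<subseteq> cube_glue S Q ` D"
    unfolding X_def by (force intro: rev_image_eqI)
  moreover have "cube_glue S Q ` D \<subseteq> Delta ar A F S \<theta>"
  proof -
    define E where "E = Delta ar A F S \<theta>"
    have hdE: "hd_congruence ar A F S E" unfolding E_def by (rule hd_congruence_Delta[OF alg con])
    define Y where "Y = {\<Gamma> \<in> cubes Q B. cube_glue S Q \<Gamma> \<in> E}"
    note I = two_pow_Int[OF _ QS] two_pow_Int[OF _ T(1)]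
    have glue_apply: "cube_glue S Q \<Gamma> = (\<lambda>f\<in>two_pow S. \<Gamma> (f \<inter> Q \<times> UNIV) (f \<inter> T \<times> UNIV))"
      for \<Gamma> :: "(nat \<times> nat) set \<Rightarrow> (nat \<times> nat) set \<Rightarrow> 'a"
      by (simp add: cube_glue_def T_def)
    have "hd_congruence ar B FB Q Y"
    proof (rule hd_congruenceI)
      show "Y \<subseteq> cubes Q B" by (auto simp: Y_def)
      fix f xs assume xs: "length xs = ar f" "set xs \<subseteq> Y"
      have "cube_glue S Q (pow_ops (two_pow Q) FB f xs) = pow_ops (two_pow S) F f (map (cube_glue S Q) xs)"
        by (auto simp: glue_apply pow_ops_def FB_def I comp_def intro!: restrict_ext)
      also have "\<dots> \<in> E" using xs by (intro hd_congruence_op[OF hdE]) (auto simp: Y_def)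
      finally show "pow_ops (two_pow Q) FB f xs \<in> Y"
        using xs pow_ops_in_cubes[OF algB, of xs f Q] by (auto simp: Y_def)
    next
      fix \<Gamma> i assume \<Gamma>: "\<Gamma> \<in> Y" and i: "i \<in> Q"
      then have iS: "i \<in> S" and i': "i \<notin> T" using QS out by auto
      {
        fix j :: nat assume j: "j = 0 \<or> j = Suc 0"
        have "cube_glue S Q (\<lambda>f\<in>two_pow Q. \<Gamma> (set_coord i j f)) = (\<lambda>f\<in>two_pow S. cube_glue S Q \<Gamma> (set_coord i j f))"
          using i iS i' j by (auto simp: glue_apply I set_coord_Int set_coord_Int_out intro!: restrict_ext)
        also have "\<dots> \<in> E" using \<Gamma> iS j by (intro hd_congruence_refl[OF hdE]) (auto simp: Y_def)
        finally show "(\<lambda>f\<in>two_pow Q. \<Gamma> (set_coord i j f)) \<in> Y"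
          using \<Gamma> i j by (auto simp: Y_def intro!: restrict_in_cubes intro: cubes_in)
      }
      have "cube_glue S Q (\<lambda>f\<in>two_pow Q. \<Gamma> (flip_coord i f)) = (\<lambda>f\<in>two_pow S. cube_glue S Q \<Gamma> (flip_coord i f))"
        using i iS i' by (auto simp: glue_apply I flip_coord_Int flip_coord_Int_out intro!: restrict_ext)
      also have "\<dots> \<in> E" using \<Gamma> iS by (intro hd_congruence_sym[OF hdE]) (auto simp: Y_def)
      finally show "(\<lambda>f\<in>two_pow Q. \<Gamma> (flip_coord i f)) \<in> Y"
        using \<Gamma> i by (auto simp: Y_def intro!: restrict_in_cubes intro: cubes_in)
      fix \<Gamma>' assume \<Gamma>': "\<Gamma>' \<in> Y"
        and eq: "\<And>f. f \<in> two_pow Q \<Longrightarrow> \<Gamma> (set_coord i (Suc 0) f) = \<Gamma>' (set_coord i 0 f)"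
      have "cube_glue S Q (cube_comp Q i \<Gamma> \<Gamma>') = cube_comp S i (cube_glue S Q \<Gamma>) (cube_glue S Q \<Gamma>')"
        using i by (auto simp: glue_apply cube_comp_def I intro!: restrict_ext)
      also have "\<dots> \<in> E"
        using \<Gamma> \<Gamma>' i iS i'
        by (intro hd_congruence_comp[OF hdE]) (auto simp: Y_def glue_apply set_coord_Int set_coord_Int_out I eq)
      finally show "cube_comp Q i \<Gamma> \<Gamma>' \<in> Y"
        using \<Gamma> \<Gamma>' by (auto simp: Y_def cube_comp_def intro!: restrict_in_cubes intro: cubes_in)
    qed
    then have "D \<subseteq> Y"
      unfolding D_def
    proof (rule Delta_least)
      fix k x y assume k: "k \<in> Q" and xy: "(x, y) \<in> \<alpha> k"
      then obtain \<gamma> where \<gamma>: "\<gamma> \<in> Delta ar A F (insert k T) \<theta>"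
        "x = cube_face (insert k T) k 0 \<gamma>" "y = cube_face (insert k T) k 1 \<gamma>"
        by (auto simp: \<alpha>_def face_rel_def)
      \<comment> \<open>A generator over \<open>B\<close> depends on its \<open>Q\<close>-vertex
        only through coordinate \<open>k\<close>. Gluing it therefore repeats \<gamma> unchanged in
        the other directions of \<open>Q\<close>.\<close>
      have "cube_glue S Q (cube_const Q k x y) = cube_dup S (insert k T) \<gamma>"
        unfolding glue_apply cube_dup_def
      proof (rule restrict_ext)
        fix f assume f: "f \<in> two_pow S"
        have kS: "k \<in> S" using k QS by auto
        \<comment> \<open>The value of the vertex at \<open>k\<close>, which selects the face of
          \<gamma> that is read.\<close>
        define j :: nat where "j = (if (k, 0) \<in> f then 0 else 1)"
        have j: "(k, j) \<in> f" using two_pow_coord[OF f kS] by (auto simp: j_def)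
        then have "f \<inter> insert k T \<times> UNIV = insert (k, j) (f \<inter> T \<times> UNIV)"
          using two_pow_unique[OF f j] by blast
        moreover have "cube_const Q k x y (f \<inter> Q \<times> UNIV) = cube_face (insert k T) k j \<gamma>"
          using I(1)[OF f] k by (simp add: cube_const_def j_def \<gamma>)
        ultimately show "cube_const Q k x y (f \<inter> Q \<times> UNIV) (f \<inter> T \<times> UNIV) = \<gamma> (f \<inter> insert k T \<times> UNIV)"
          using I(2)[OF f] by (simp add: cube_face_apply iT[OF k])
      qed
      also have "\<dots> \<in> E" unfolding E_def by (rule Delta_dup[OF alg con iT(1)[OF k] \<gamma>(1)])
      finally show "cube_const Q k x y \<in> Y"
        using \<alpha>_con k xy congruence_in[of ar B FB "\<alpha> k" x y]
        by (auto simp: Y_def cube_const_def intro!: restrict_in_cubes)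
    qed
    then show ?thesis by (auto simp: Y_def E_def)
  qed
  ultimately show "Delta ar A F S \<theta> = cube_glue S Q ` Delta ar B FB Q \<alpha>" by (simp add: D_def)
qed

theorem theorem2p10:
  fixes ar :: "'f \<Rightarrow> nat" and A :: "'a set" and F :: "'f \<Rightarrow> 'a list \<Rightarrow> 'a"
    and S Q :: "nat set" and \<theta> :: "nat \<Rightarrow> 'a rel"
  assumes alg: "algebra ar A F"
    and cm: "in_cm_variety ar A F"
    and finS: "finite S" and cardS: "card S \<ge> 3"
    and con: "\<forall>k\<in>S. congruence ar A F (\<theta> k)"
    and QS: "Q \<subseteq> S" and Qne: "Q \<noteq> {}" and QneS: "Q \<noteq> S"
  shows "let B = Delta ar A F (S - Q) \<theta>;
             FB = pow_ops (two_pow (S - Q)) F;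
             \<alpha> = (\<lambda>i. face_rel (insert i (S - Q)) i (Delta ar A F (insert i (S - Q)) \<theta>))
         in (\<forall>i\<in>Q. congruence ar B FB (\<alpha> i)) \<and>
            Delta ar A F S \<theta> = cube_glue S Q ` Delta ar B FB Q \<alpha>"
  unfolding Let_def using Delta_eq_glue_Delta[OF alg cm finS con QS Qne QneS] by (rule conjI)

end
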